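(* For any $\gamma=\begin{pmatrix}a&b\\c&d\end{pmatrix}\in\Gamma$, the extensions to $B$ and $C$ of the homographic action of $\Gamma$ on $R$ satisfy $$(x|\gamma)=\sum_{n\ge0}(n+1)!\,(cz+d)^{-2}\left(\frac{c}{cz+d}\right)^{n}x^{n+1},$$ $$(y|\gamma)=\sum_{u\ge0}\frac{(2u+1)!\,(2u)!}{16^{u}\,(u!)^3}\,(cz+d)^{-1}\left(\frac{c}{cz+d}\right)^{u}y^{2u+1}.$$
   Context: $\Gamma$ is a subgroup of $\mathrm{SL}(2,\mathbb{C})$ and $R$ is a commutative $\mathbb{C}$-algebra of functions in one variable $z$, which is a domain, such that: (i) $\Gamma$ acts on the right on $R$ by automorphisms $(f\cdot\gamma)(z)=f\left(\frac{az+b}{cz+d}\right)$ for $\gamma=\begin{pmatrix}a&b\\c&d\end{pmatrix}$; (ii) the function $z\mapsto cz+d$ is an invertible element of $R$ for every $\gamma\in\Gamma$; (iii) $R$ is stable under $\partial_z=\frac{d}{dz}$, which is nonzero on $R$. Put $d_z=-\partial_z$, $\delta_z=\frac12d_z$. $C=R(\!(y;\delta_z)\!)_2$ is the ring of Laurent series $\sum_{i\ge m}f_iy^i$ ($m\in\mathbb{Z}$, $f_i\in R$) with multiplication determined by $yf=\sum_{k\ge0}\frac{(2k)!}{2^k(k!)^2}\delta_z^k(f)y^{2k+1}$ for $f\in R$. With $x=y^2$ it contains the subring $B=R(\!(x;d_z)\!)$ of Laurent series in $x$, where $xf=\sum_{n\ge0}d_z^n(f)x^{n+1}$, equivalently $x^{-1}f=fx^{-1}+\partial_z(f)$.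 The homographic action extends to an action by automorphisms $q\mapsto(q|\gamma)$ on $B$ defined by $(x^{-1}|\gamma)=(cz+d)^2x^{-1}$, and on $C$ defined by letting $(y|\gamma)$ be the square root in $C$ of $(x|\gamma)=x(cz+d)^{-2}$ whose term of minimal valuation is $(cz+d)^{-1}y$; explicitly $(\sum f_ny^n|\gamma)=\sum(f_n\cdot\gamma)(y|\gamma)^n$, and the action on $B$ is the restriction of the action on $C$. *)

theory Defs
  imports "HOL-Analysis.Analysis" "HOL-Computational_Algebra.Formal_Laurent_Series"
begin

subsection \<open>Homographies and algebras of functions in one variable\<close>

definition denom :: "complex^2^2 \<Rightarrow> complex \<Rightarrow> complex" where
  "denom \<gamma> z = \<gamma>$2$1 * z + \<gamma>$2$2"

definition homography :: "complex^2^2 \<Rightarrow> complex \<Rightarrow> complex" where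
  "homography \<gamma> z = (\<gamma>$1$1 * z + \<gamma>$1$2) / denom \<gamma> z"

text \<open>
  The algebra of functions is a type \<open>'r\<close> together with an evaluation map \<open>ev\<close>, which sends an
  element to the underlying function. Functions may have singularities, so all identities between
  functions are required on the open set \<open>U\<close> only up to a sparse set of exceptional points. Two
  typical instances are algebras of holomorphic functions on a half plane \<open>U\<close> and the field of
  rational functions with \<open>U = UNIV\<close>.

  Since \<open>ev\<close> is faithful, the element \<open>f\<cdot>\<gamma>\<close> in \<open>homographic_closed\<close> is unique, and it is a formal
  consequence of the assumptions that \<open>f \<mapsto> f\<cdot>\<gamma>\<close> is a right action by algebra automorphisms and that
  differentiation is a derivation. That \<open>'r\<close> is a commutative domain is the class \<open>idom\<close>.
\<close>

locale homographic_algebra =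
  fixes \<Gamma> :: "(complex^2^2) set"
    and U :: "complex set"
    and ev :: "'r::idom \<Rightarrow> complex \<Rightarrow> complex"
  assumes det_one: "\<gamma> \<in> \<Gamma> \<Longrightarrow> det \<gamma> = 1"
    and one_closed: "mat 1 \<in> \<Gamma>"
    and mult_closed: "\<gamma> \<in> \<Gamma> \<Longrightarrow> \<gamma>' \<in> \<Gamma> \<Longrightarrow> \<gamma> ** \<gamma>' \<in> \<Gamma>"
    and inv_closed: "\<gamma> \<in> \<Gamma> \<Longrightarrow> matrix_inv \<gamma> \<in> \<Gamma>"
    and open_U: "open U"
    and U_stable: "\<gamma> \<in> \<Gamma> \<Longrightarrow> z \<in> U \<Longrightarrow> denom \<gamma> z \<noteq> 0 \<Longrightarrow> homography \<gamma> z \<in> U"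
    and ev_faithful: "(\<forall>\<^sub>F z in cosparse U. ev f z = ev g z) \<Longrightarrow> f = g"
    and ev_add: "\<forall>\<^sub>F z in cosparse U. ev (f + g) z = ev f z + ev g z"
    and ev_mult: "\<forall>\<^sub>F z in cosparse U. ev (f * g) z = ev f z * ev g z"
    and ev_one: "\<forall>\<^sub>F z in cosparse U. ev 1 z = 1"
    and ev_const: "\<exists>f. \<forall>\<^sub>F z in cosparse U. ev f z = k"
    and homographic_closed:
      "\<gamma> \<in> \<Gamma> \<Longrightarrow> \<exists>g. \<forall>\<^sub>F z in cosparse U. ev g z = ev f (homography \<gamma> z)"
    and denom_invertible:
      "\<gamma> \<in> \<Gamma> \<Longrightarrow> \<exists>j. (\<forall>\<^sub>F z in cosparse U. ev j z = denom \<gamma> z) \<and> j dvd 1"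
    and deriv_closed:
      "\<exists>g. \<forall>\<^sub>F z in cosparse U. (ev f has_field_derivative ev g z) (at z)"
    and deriv_nonzero:
      "\<exists>f. \<not> (\<forall>\<^sub>F z in cosparse U. (ev f has_field_derivative 0) (at z))"

definition elem :: "complex set \<Rightarrow> ('r::idom \<Rightarrow> complex \<Rightarrow> complex) \<Rightarrow> (complex \<Rightarrow> complex) \<Rightarrow> 'r" where
  "elem U ev h = (THE f. \<forall>\<^sub>F z in cosparse U. ev f z = h z)"

definition scalar :: "complex set \<Rightarrow> ('r::idom \<Rightarrow> complex \<Rightarrow> complex) \<Rightarrow> complex \<Rightarrow> 'r" where
  "scalar U ev k = elem U ev (\<lambda>_. k)"

definition hom_act ::
  "complex set \<Rightarrow> ('r::idom \<Rightarrow> complex \<Rightarrow> complex) \<Rightarrow> complex^2^2 \<Rightarrow> 'r \<Rightarrow> 'r" where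
  "hom_act U ev \<gamma> f = elem U ev (\<lambda>z. ev f (homography \<gamma> z))"

definition partial_z :: "complex set \<Rightarrow> ('r::idom \<Rightarrow> complex \<Rightarrow> complex) \<Rightarrow> 'r \<Rightarrow> 'r" where
  "partial_z U ev f = (THE g. \<forall>\<^sub>F z in cosparse U. (ev f has_field_derivative ev g z) (at z))"

definition d_z :: "complex set \<Rightarrow> ('r::idom \<Rightarrow> complex \<Rightarrow> complex) \<Rightarrow> 'r \<Rightarrow> 'r" where
  "d_z U ev f = - partial_z U ev f"

definition delta_z :: "complex set \<Rightarrow> ('r::idom \<Rightarrow> complex \<Rightarrow> complex) \<Rightarrow> 'r \<Rightarrow> 'r" where
  "delta_z U ev f = scalar U ev (1/2) * d_z U ev f"

subsection \<open>Skew Laurent series\<close>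

notation fls_nth (infixl "$$" 75)

text \<open>
  Both rings of Laurent series in a variable \<open>w\<close> have the additive group \<open>'r fls\<close>, a series
  standing for \<open>\<Sum>i. f\<^sub>i w\<^sup>i\<close> with coefficients on the left; \<open>w\<close> itself is \<open>fls_X\<close>. The
  multiplication is not the commutative one of \<open>fls\<close>: it is determined by a commutation rule
  \<open>w f = \<Sum>k. a\<^sub>k D\<^sup>k(f) w\<^bsup>1+sk\<^esup>\<close>. The map \<open>lmul_gen s a D\<close> is left multiplication by \<open>w\<close>.
  The sum is over all \<open>k\<close>: terms with \<open>k\<close> beyond the bound vanish since they involve
  coefficients below the valuation.
\<close>

definition lmul_gen :: "nat \<Rightarrow> (nat \<Rightarrow> 'r) \<Rightarrow> ('r \<Rightarrow> 'r) \<Rightarrow> 'r fls \<Rightarrow> 'r::comm_ring_1 fls" where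
  "lmul_gen s a D G = Abs_fls (\<lambda>m. \<Sum>k\<le>nat (m - fls_subdegree G).
     a k * (D ^^ k) (G $$ (m - (1 + int s * int k))))"

definition int_iterate :: "('a \<Rightarrow> 'a) \<Rightarrow> int \<Rightarrow> 'a \<Rightarrow> 'a" where
  "int_iterate T i = (if i \<ge> 0 then T ^^ nat i else (inv T) ^^ nat (- i))"

text \<open>
  With \<open>T\<close> the bijection \<open>G \<mapsto> w G\<close>, which raises valuations by one, the product is
  \<open>F G = \<Sum>i. f\<^sub>i (w\<^sup>i G)\<close>; only the indices \<open>i\<close> below contribute to its coefficient at \<open>m\<close>.
\<close>

definition skew_mult :: "('r fls \<Rightarrow> 'r fls) \<Rightarrow> 'r fls \<Rightarrow> 'r fls \<Rightarrow> 'r::comm_ring_1 fls" where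
  "skew_mult T F G = Abs_fls (\<lambda>m. \<Sum>i = fls_subdegree F..m - fls_subdegree G.
     F $$ i * int_iterate T i G $$ m)"

definition skew_inverse :: "('r fls \<Rightarrow> 'r fls) \<Rightarrow> 'r fls \<Rightarrow> 'r::comm_ring_1 fls" where
  "skew_inverse T F = (THE G. skew_mult T F G = 1 \<and> skew_mult T G F = 1)"

definition skew_powi :: "('r fls \<Rightarrow> 'r fls) \<Rightarrow> 'r fls \<Rightarrow> int \<Rightarrow> 'r::comm_ring_1 fls" where
  "skew_powi T F i = (if i \<ge> 0 then (skew_mult T F ^^ nat i) 1
                      else (skew_mult T (skew_inverse T F) ^^ nat (- i)) 1)"

text \<open>
  The map \<open>\<Sum>i. f\<^sub>i w\<^sup>i \<mapsto> \<Sum>i. \<alpha>(f\<^sub>i) S\<^sup>i\<close>, for \<open>S\<close> of valuation one.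
\<close>

definition skew_extend ::
  "('r fls \<Rightarrow> 'r fls) \<Rightarrow> ('r \<Rightarrow> 'r) \<Rightarrow> 'r fls \<Rightarrow> 'r fls \<Rightarrow> 'r::comm_ring_1 fls" where
  "skew_extend T \<alpha> S F = Abs_fls (\<lambda>m. \<Sum>i = fls_subdegree F..m.
     \<alpha> (F $$ i) * skew_powi T S i $$ m)"

text \<open>The series \<open>\<Sum>n. h\<^sub>n w\<^bsup>e(n)\<^esup>\<close>, for injective \<open>e\<close>.\<close>

definition laurent_sum :: "(nat \<Rightarrow> nat) \<Rightarrow> (nat \<Rightarrow> 'r) \<Rightarrow> 'r::comm_ring_1 fls" where
  "laurent_sum e h = Abs_fls (\<lambda>m. \<Sum>n | int (e n) = m. h n)"

lemma lmul_gen_nth: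
  assumes "D 0 = 0"
  shows "lmul_gen s a D G $$ m = (\<Sum>k\<le>nat (m - fls_subdegree G).
     a k * (D ^^ k) (G $$ (m - (1 + int s * int k))))"
proof -
  have D0: "(D ^^ k) 0 = 0" for k
    using assms by (induction k) auto
  have "(\<Sum>k\<le>nat (m - fls_subdegree G). a k * (D ^^ k) (G $$ (m - (1 + int s * int k)))) = 0"
    if "m < fls_subdegree G" for m
  proof (intro sum.neutral ballI)
    fix k
    have "m - (1 + int s * int k) < fls_subdegree G"
      using that by (smt (verit) of_nat_0_le_iff mult_nonneg_nonneg)
    then show "a k * (D ^^ k) (G $$ (m - (1 + int s * int k))) = 0"
      by (simp add: D0)
  qed
  then show ?thesis
    unfolding lmul_gen_def by (intro nth_Abs_fls_lower_bound) blast
qed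

text \<open>The commutation rule \<open>w f = \<Sum>k. a\<^sub>k D\<^sup>k(f) w\<^bsup>1+sk\<^esup>\<close> holds for the product defined above.\<close>

lemma skew_mult_X_const:
  fixes f :: "'r::comm_ring_1"
  assumes D0: "D 0 = 0" and s: "s > 0"
  shows "skew_mult (lmul_gen s a D) fls_X (fls_const f)
       = laurent_sum (\<lambda>k. 1 + s * k) (\<lambda>k. a k * (D ^^ k) f)"
proof -
  let ?T = "lmul_gen s a D"
  have Dk0: "(D ^^ k) 0 = 0" for k
    using D0 by (induction k) auto
  have T: "?T (fls_const f) $$ m = (\<Sum>k | int (1 + s * k) = m. a k * (D ^^ k) f)" for m
  proof -
    have "{k. int (1 + s * k) = m} \<subseteq> {..nat m}"
    proof
      fix k assume "k \<in> {k. int (1 + s * k) = m}"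
      then have "m = int (1 + s * k)" by simp
      then have "nat m = 1 + s * k" by (simp only: nat_int)
      moreover have "k \<le> 1 + s * k" using s by (cases s) auto
      ultimately show "k \<in> {..nat m}" by (simp only: atMost_iff)
    qed
    then have "(\<Sum>k | int (1 + s * k) = m. a k * (D ^^ k) f)
        = (\<Sum>k\<le>nat m. a k * (D ^^ k) (fls_const f $$ (m - (1 + int s * int k))))"
      by (intro sum.mono_neutral_cong_left) (auto simp: Dk0)
    then show ?thesis
      by (simp add: lmul_gen_nth[where D = D, OF D0])
  qed
  have low: "(\<Sum>k | int (1 + s * k) = m. a k * (D ^^ k) f) = 0" if "m < 1" for m
  proof -
    have "int (1 + s * k) \<noteq> m" for k
      using that of_nat_0_le_iff[of "s * k", where 'a = int] unfolding of_nat_add of_nat_1 by linarith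
    then have "{k. int (1 + s * k) = m} = {}" by blast
    then show ?thesis by (metis sum.empty)
  qed
  have "(\<Sum>i = 1..m. fls_X $$ i * int_iterate ?T i (fls_const f) $$ m)
      = (\<Sum>k | int (1 + s * k) = m. a k * (D ^^ k) f)" for m
  proof (cases "m \<ge> 1")
    case True
    have "(\<Sum>i = 1..m. fls_X $$ i * int_iterate ?T i (fls_const f) $$ m)
        = (\<Sum>i \<in> {1}. fls_X $$ i * int_iterate ?T i (fls_const f) $$ m)"
      using True by (intro sum.mono_neutral_right) auto
    then show ?thesis by (simp add: int_iterate_def T)
  next
    case False
    then show ?thesis using low by simp
  qed
  then show ?thesis
    by (simp add: skew_mult_def laurent_sum_def)
qed

subsection \<open>The rings $B = R((x; d_z))$ and $C = R((y; \delta_z))_2$\<close>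

definition lmul_x :: "complex set \<Rightarrow> ('r::idom \<Rightarrow> complex \<Rightarrow> complex) \<Rightarrow> 'r fls \<Rightarrow> 'r fls" where
  "lmul_x U ev = lmul_gen 1 (\<lambda>_. 1) (d_z U ev)"

definition lmul_y :: "complex set \<Rightarrow> ('r::idom \<Rightarrow> complex \<Rightarrow> complex) \<Rightarrow> 'r fls \<Rightarrow> 'r fls" where
  "lmul_y U ev = lmul_gen 2 (\<lambda>k. scalar U ev (fact (2*k) / (2^k * (fact k)^2))) (delta_z U ev)"

abbreviation mult_B ::
  "complex set \<Rightarrow> ('r::idom \<Rightarrow> complex \<Rightarrow> complex) \<Rightarrow> 'r fls \<Rightarrow> 'r fls \<Rightarrow> 'r fls" where
  "mult_B U ev \<equiv> skew_mult (lmul_x U ev)"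

abbreviation mult_C ::
  "complex set \<Rightarrow> ('r::idom \<Rightarrow> complex \<Rightarrow> complex) \<Rightarrow> 'r fls \<Rightarrow> 'r fls \<Rightarrow> 'r fls" where
  "mult_C U ev \<equiv> skew_mult (lmul_y U ev)"

text \<open>The inclusion of \<open>B\<close> in \<open>C\<close> with \<open>x = y\<^sup>2\<close>.\<close>

definition B_to_C :: "'r::idom fls \<Rightarrow> 'r fls" where
  "B_to_C F = fls_compose_power F 2"

text \<open>\<open>(x|\<gamma>)\<close> is the inverse in \<open>B\<close> of \<open>(x\<inverse>|\<gamma>) = (cz+d)\<^sup>2 x\<inverse>\<close>.\<close>

definition x_image ::
  "complex set \<Rightarrow> ('r::idom \<Rightarrow> complex \<Rightarrow> complex) \<Rightarrow> complex^2^2 \<Rightarrow> 'r fls" where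
  "x_image U ev \<gamma> = skew_inverse (lmul_x U ev)
     (mult_B U ev (fls_const ((elem U ev (denom \<gamma>))^2)) fls_X_inv)"

definition y_image ::
  "complex set \<Rightarrow> ('r::idom \<Rightarrow> complex \<Rightarrow> complex) \<Rightarrow> complex^2^2 \<Rightarrow> 'r fls" where
  "y_image U ev \<gamma> = (THE S. mult_C U ev S S = B_to_C (x_image U ev \<gamma>) \<and>
     fls_subdegree S = 1 \<and> S $$ 1 = elem U ev (\<lambda>z. 1 / denom \<gamma> z))"

definition act_B ::
  "complex set \<Rightarrow> ('r::idom \<Rightarrow> complex \<Rightarrow> complex) \<Rightarrow> complex^2^2 \<Rightarrow> 'r fls \<Rightarrow> 'r fls" where
  "act_B U ev \<gamma> = skew_extend (lmul_x U ev) (hom_act U ev \<gamma>) (x_image U ev \<gamma>)"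

definition act_C ::
  "complex set \<Rightarrow> ('r::idom \<Rightarrow> complex \<Rightarrow> complex) \<Rightarrow> complex^2^2 \<Rightarrow> 'r fls \<Rightarrow> 'r fls" where
  "act_C U ev \<gamma> = skew_extend (lmul_y U ev) (hom_act U ev \<gamma>) (y_image U ev \<gamma>)"

end

theory Submission
  imports Defs
begin

text \<open>
  Let \<open>p = cz+d\<close> and \<open>v = 1/p\<close>, so that \<open>\<partial>v = -c v\<^sup>2\<close>. In both rings the power \<open>x\<^sup>s\<close>, with \<open>s\<close> an integer
  in \<open>B\<close> and a half-integer in \<open>C\<close> (where \<open>y = x\<^sup>1\<^sup>/\<^sup>2\<close>), obeys the one rule
  \<open>x\<^sup>s f = \<Sum>\<^sub>k (-s choose k) \<partial>\<^sup>k(f) x\<^sup>s\<^sup>+\<^sup>k\<close>; that is, \<open>x\<close> behaves like \<open>\<partial>\<close> to the power \<open>-1\<close>. Left multiplication by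
  a power of the variable is therefore a binomial series in commuting operators, and these series
  compose by Vandermonde's identity (\<open>binomial_shift_binomial_shift\<close>). This puts every coefficient
  of every product within reach.

  In \<open>B\<close>, the inverse of \<open>p\<^sup>2 x\<^sup>-\<^sup>1\<close> is \<open>x v\<^sup>2\<close>
  (\<open>skew_inverse_const_X_inv\<close>, by Leibniz' rule). Its coefficients are the iterates of \<open>-\<partial>\<close> on
  \<open>v\<^sup>2\<close>, which gives the first formula.

  In \<open>C\<close>, the origin of the formula is Bol's identity
  \<open>(p\<^sup>2 \<partial>)\<^sup>s = p\<^sup>s\<^sup>+\<^sup>1 \<partial>\<^sup>s p\<^sup>s\<^sup>-\<^sup>1\<close>: the choice \<open>s = -1\<close> gives \<open>x v\<^sup>2\<close>, and \<open>s = -1/2\<close> suggests that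
  its square root is \<open>p\<^sup>1\<^sup>/\<^sup>2 y v\<^sup>3\<^sup>/\<^sup>2\<close>. Expanding this by the rule above produces coefficients
  \<open>(1/2)\<^sub>u (3/2)\<^sub>u / u!\<close>, in which all fractional powers of \<open>p\<close> have cancelled. Since those powers
  need not exist in the algebra, the square of the resulting series is computed directly, and the
  claim becomes the numerical identity \<open>sqrt_coeff_convolution\<close>: a Vandermonde summation
  followed by a partial fraction expansion. Square roots with a given leading term are unique,
  because the lowest term of the difference of two such roots would be killed by twice their common
  leading coefficient (\<open>skew_square_root_unique\<close>).

  Finally, the action sends the variable \<open>w\<close> of the ring to \<open>(1\<cdot>\<gamma>) (w|\<gamma>)\<close>, so \<open>1\<cdot>\<gamma> = 1\<close> is needed
  (\<open>hom_act_const\<close>). This is delicate at the pole of the homography only.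
\<close>

section \<open>The convolution identity for the square root\<close>

text \<open>
  Pascal's rule turns an \<open>(n+1)\<close>-st finite difference into the \<open>n\<close>-th finite difference of the
  first difference. It drives the inductions on \<open>n\<close> below.
\<close>

lemma binomial_alternating_sum_Suc:
  fixes f :: "nat \<Rightarrow> 'a::comm_ring_1"
  shows "(\<Sum>j\<le>Suc n. (-1)^j * of_nat (Suc n choose j) * f j)
       = (\<Sum>j\<le>n. (-1)^j * of_nat (n choose j) * (f j - f (Suc j)))"
proof -
  have "(\<Sum>j\<le>Suc n. (-1)^j * of_nat (Suc n choose j) * f j)
      = f 0 + (\<Sum>j\<le>n. (-1)^Suc j * of_nat (n choose Suc j) * f (Suc j))
          + (\<Sum>j\<le>n. (-1)^Suc j * of_nat (n choose j) * f (Suc j))"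
    by (subst sum.atMost_Suc_shift) (simp add: algebra_simps sum.distrib sum_negf sum_subtractf)
  also have "f 0 + (\<Sum>j\<le>n. (-1)^Suc j * of_nat (n choose Suc j) * f (Suc j))
      = (\<Sum>j\<le>Suc n. (-1)^j * of_nat (n choose j) * f j)"
    by (subst sum.atMost_Suc_shift) simp
  also have "\<dots> = (\<Sum>j\<le>n. (-1)^j * of_nat (n choose j) * f j)"
    by (simp add: binomial_eq_0)
  finally show ?thesis
    by (simp add: algebra_simps sum.distrib sum_negf sum_subtractf)
qed

text \<open>
  The \<open>n\<close>-th finite difference of a polynomial of degree \<open>m < n\<close> vanishes: one difference turns
  \<open>pochhammer\<close> of degree \<open>m\<close> into \<open>m\<close> times the one of degree \<open>m - 1\<close>.
\<close>

lemma binomial_alternating_sum_pochhammer: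
  fixes y :: "'a::field_char_0"
  assumes "m < n"
  shows "(\<Sum>j\<le>n. (-1)^j * of_nat (n choose j) * pochhammer (y - of_nat j) m) = 0"
  using assms
proof (induction n arbitrary: m y)
  case 0
  then show ?case by simp
next
  case (Suc n)
  show ?case
  proof (cases m)
    case 0
    then show ?thesis
      by (subst binomial_alternating_sum_Suc) simp
  next
    case (Suc m')
    have diff: "pochhammer (y - of_nat j) m - pochhammer (y - of_nat (Suc j)) m
        = of_nat m * pochhammer (y - of_nat j) m'" for j
    proof -
      have A: "pochhammer (y - of_nat (Suc j)) m = (y - of_nat (Suc j)) * pochhammer (y - of_nat j) m'"
        unfolding Suc by (subst pochhammer_rec) simp
      have B: "pochhammer (y - of_nat j) m = (y - of_nat j + of_nat m') * pochhammer (y - of_nat j) m'"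
        unfolding Suc by (rule pochhammer_rec')
      show ?thesis
        unfolding A B by (simp add: Suc algebra_simps)
    qed
    have "(\<Sum>j\<le>n. (-1)^j * of_nat (n choose j) * (of_nat m * pochhammer (y - of_nat j) m'))
        = of_nat m * (\<Sum>j\<le>n. (-1)^j * of_nat (n choose j) * pochhammer (y - of_nat j) m')"
      by (simp add: sum_distrib_left mult_ac)
    also have "\<dots> = 0"
      using Suc.IH[of m' y] Suc.prems Suc by simp
    finally show ?thesis
      by (subst binomial_alternating_sum_Suc) (simp only: diff)
  qed
qed

lemma pochhammer_partial_fractions_one:
  fixes x :: "'a::field_char_0"
  assumes "\<And>j::nat. x + of_nat j \<noteq> 0"
  shows "(\<Sum>j\<le>n. (-1)^j * of_nat (n choose j) * (1 / (x + of_nat j))) = fact n / pochhammer x (Suc n)"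
  using assms
proof (induction n arbitrary: x)
  case 0
  then show ?case by simp
next
  case (Suc n)
  have nz: "x + 1 + of_nat j \<noteq> 0" for j :: nat
    using Suc.prems[of "Suc j"] by (simp add: add_ac)
  have x0: "x \<noteq> 0"
    using Suc.prems[of 0] by simp
  have p0: "pochhammer (x + 1) n \<noteq> 0"
    using nz by (auto simp: pochhammer_eq_0_iff add_eq_0_iff2)
  have p1: "pochhammer x (Suc n) = x * pochhammer (x + 1) n"
    by (rule pochhammer_rec)
  have p2: "pochhammer (x + 1) (Suc n) = (x + 1 + of_nat n) * pochhammer (x + 1) n"
    by (rule pochhammer_rec')
  have p3: "pochhammer x (Suc (Suc n)) = x * ((x + 1 + of_nat n) * pochhammer (x + 1) n)"
    by (subst pochhammer_rec) (simp only: p2)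
  have "(\<Sum>j\<le>Suc n. (-1)^j * of_nat (Suc n choose j) * (1 / (x + of_nat j)))
      = (\<Sum>j\<le>n. (-1)^j * of_nat (n choose j) * (1 / (x + of_nat j)))
      - (\<Sum>j\<le>n. (-1)^j * of_nat (n choose j) * (1 / (x + 1 + of_nat j)))"
    by (subst binomial_alternating_sum_Suc) (simp add: right_diff_distrib sum_subtractf add_ac)
  also have "\<dots> = fact n / pochhammer x (Suc n) - fact n / pochhammer (x + 1) (Suc n)"
    using Suc.IH[of x] Suc.IH[of "x + 1"] Suc.prems nz by simp
  also have "\<dots> = fact (Suc n) / pochhammer x (Suc (Suc n))"
    unfolding p1 p2 p3 using x0 p0 nz[of n] by (simp add: divide_simps) (simp add: algebra_simps)
  finally show ?case .
qed

text \<open>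
  The partial fraction expansion of \<open>(y+x)\<^sub>m / (x)\<^sub>n\<^sub>+\<^sub>1\<close>, whose poles in \<open>x\<close> are \<open>-j\<close> with
  \<open>j \<le> n\<close>. Passing from \<open>m\<close> to \<open>m+1\<close> multiplies each summand by
  \<open>y - j + m = (y + x + m) - (x + j)\<close>; the part with \<open>x + j\<close> cancels the pole and sums to zero, being
  a high finite difference.
\<close>

lemma pochhammer_partial_fractions:
  fixes x y :: "'a::field_char_0"
  assumes x: "\<And>j::nat. x + of_nat j \<noteq> 0" and "m \<le> n"
  shows "(\<Sum>j\<le>n. (-1)^j * of_nat (n choose j) * (pochhammer (y - of_nat j) m / (x + of_nat j)))
       = fact n * pochhammer (y + x) m / pochhammer x (Suc n)"
  using \<open>m \<le> n\<close>
proof (induction m)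
  case 0
  then show ?case
    using pochhammer_partial_fractions_one[OF x] by simp
next
  case (Suc m)
  have "pochhammer (y - of_nat j) (Suc m) / (x + of_nat j)
      = (y + x + of_nat m) * (pochhammer (y - of_nat j) m / (x + of_nat j)) - pochhammer (y - of_nat j) m"
    for j
  proof -
    have "y - of_nat j + of_nat m = (y + x + of_nat m) - (x + of_nat j)"
      by simp
    then show ?thesis
      using x[of j] by (simp only: pochhammer_rec' left_diff_distrib diff_divide_distrib) simp
  qed
  then have "(\<Sum>j\<le>n. (-1)^j * of_nat (n choose j) * (pochhammer (y - of_nat j) (Suc m) / (x + of_nat j)))
      = (y + x + of_nat m)
          * (\<Sum>j\<le>n. (-1)^j * of_nat (n choose j) * (pochhammer (y - of_nat j) m / (x + of_nat j)))
        - (\<Sum>j\<le>n. (-1)^j * of_nat (n choose j) * pochhammer (y - of_nat j) m)"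
    by (simp add: right_diff_distrib sum_subtractf sum_distrib_left mult_ac)
  then show ?case
    using Suc binomial_alternating_sum_pochhammer[of m n y] by (simp add: pochhammer_rec')
qed

lemma three_halves_add_of_nat_nonzero: "3/2 + of_nat j \<noteq> (0::'a::field_char_0)"
proof
  assume "3/2 + of_nat j = (0::'a)"
  then have "of_nat (3 + 2 * j) = (0::'a)" by (simp add: field_simps)
  then show False by (simp only: of_nat_eq_0_iff)
qed

text \<open>
  The number that accompanies \<open>v\<^sup>i\<^sup>+\<^sup>1 c\<^sup>i y\<^sup>2\<^sup>i\<^sup>+\<^sup>1\<close> in the expansion of \<open>p\<^sup>1\<^sup>/\<^sup>2 y v\<^sup>3\<^sup>/\<^sup>2\<close>:
  \<open>(1/2)\<^sub>i / i!\<close> comes from moving \<open>y\<close> across a function, and \<open>(3/2)\<^sub>i\<close> from differentiating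
  \<open>v\<^sup>3\<^sup>/\<^sup>2\<close>.
\<close>

definition sqrt_coeff :: "nat \<Rightarrow> 'a::field_char_0" where
  "sqrt_coeff i = pochhammer (1/2) i * pochhammer (3/2) i / fact i"

lemma sqrt_coeff_fact:
  "sqrt_coeff u = (fact (2 * u + 1) * fact (2 * u) / (16 ^ u * fact u ^ 3) :: 'a::field_char_0)"
proof -
  have A: "pochhammer (1/2) u = (fact (2 * u) / (4 ^ u * fact u) :: 'a)"
    by (simp add: fact_double power_mult)
  have "pochhammer (1/2) (Suc u) = (1/2 :: 'a) * pochhammer (3/2) u"
    by (subst pochhammer_rec) simp
  moreover have "pochhammer (1/2) (Suc u) = (1/2 + of_nat u :: 'a) * pochhammer (1/2) u"
    by (rule pochhammer_rec')
  ultimately have "pochhammer (3/2) u = 2 * ((1/2 + of_nat u :: 'a) * pochhammer (1/2) u)"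
    by (simp add: mult_ac)
  then have B: "pochhammer (3/2) u = (fact (2 * u + 1) / (4 ^ u * fact u) :: 'a)"
    by (simp add: A algebra_simps add_divide_distrib)
  have "(16::'a) ^ u = 4 ^ u * 4 ^ u"
    by (simp flip: power_mult_distrib)
  then show ?thesis
    unfolding sqrt_coeff_def A B by (simp add: power3_eq_cube mult_ac)
qed

text \<open>
  For fixed \<open>j\<close> the inner sum of the convolution is a Chu-Vandermonde sum, since the two factors with
  parameter \<open>1/2\<close> merge into \<open>(1/2)\<^sub>n\<^sub>-\<^sub>j\<close>. The result is written as a summand of the
  partial fraction expansion with \<open>x = 3/2\<close> and \<open>y = 1/2\<close>: the factors \<open>(1/2)\<^sub>j (1/2)\<^sub>n\<^sub>-\<^sub>j\<close> are, up to
  sign, the value at \<open>-j\<close> of the polynomial \<open>(1/2 + x)\<^sub>n\<close>.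
\<close>

lemma sqrt_coeff_fixed_right:
  fixes n j :: nat
  assumes "j \<le> n"
  shows "(\<Sum>p\<le>n-j. sqrt_coeff p * sqrt_coeff j
           * (pochhammer (of_nat p + 1/2) (n - j - p) / fact (n - j - p))
           * pochhammer (of_nat j + 1) (n - j - p))
       = (pochhammer (3/2) (Suc n) / fact n) * ((-1)^j * of_nat (n choose j)
           * (pochhammer (1/2 - of_nat j) n / (3/2 + of_nat j)) :: 'a::field_char_0)"
proof -
  define m where "m = n - j"
  have n: "n = j + m" using assms by (simp add: m_def)
  have "sqrt_coeff p * sqrt_coeff j * (pochhammer (of_nat p + 1/2) (m - p) / fact (m - p))
           * pochhammer (of_nat j + 1) (m - p)
       = sqrt_coeff j * pochhammer (1/2) m / fact m
         * (of_nat (m choose p) * pochhammer (3/2) p * pochhammer (of_nat j + 1) (m - p) :: 'a)"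
    if "p \<le> m" for p
  proof -
    have "pochhammer (1/2) m = (pochhammer (1/2) p * pochhammer (of_nat p + 1/2) (m - p) :: 'a)"
      using pochhammer_product[OF that, of "1/2"] by (simp add: add_ac)
    then show ?thesis
      using that by (simp add: binomial_fact sqrt_coeff_def) (simp add: mult_ac)
  qed
  then have "(\<Sum>p\<le>m. sqrt_coeff p * sqrt_coeff j * (pochhammer (of_nat p + 1/2) (m - p) / fact (m - p))
           * pochhammer (of_nat j + 1) (m - p))
       = sqrt_coeff j * pochhammer (1/2) m / fact m
         * (\<Sum>p\<le>m. of_nat (m choose p) * pochhammer (3/2) p * pochhammer (of_nat j + 1) (m - p) :: 'a)"
    by (simp add: sum_distrib_left)
  also have "(\<Sum>p\<le>m. of_nat (m choose p) * pochhammer (3/2) p * pochhammer (of_nat j + 1) (m - p))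
      = pochhammer (3/2 + of_nat (Suc j) :: 'a) m"
    using pochhammer_binomial_sum[of "3/2 :: 'a" "of_nat j + 1" m] by (simp add: add_ac)
  also have "sqrt_coeff j * pochhammer (1/2) m / fact m * pochhammer (3/2 + of_nat (Suc j)) m
      = (pochhammer (3/2) (Suc n) / fact n) * ((-1)^j * of_nat (n choose j)
           * (pochhammer (1/2 - of_nat j) n / (3/2 + of_nat j)) :: 'a)"
  proof -
    have nz: "3/2 + of_nat j \<noteq> (0::'a)"
      by (rule three_halves_add_of_nat_nonzero)
    have "pochhammer (3/2) (Suc n) = pochhammer (3/2) (Suc j) * pochhammer (3/2 + of_nat (Suc j) :: 'a) m"
      using pochhammer_product'[of "3/2 :: 'a" "Suc j" m] by (simp add: n)
    also have "pochhammer (3/2) (Suc j) = (3/2 + of_nat j) * (pochhammer (3/2) j :: 'a)"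
      by (rule pochhammer_rec')
    finally have 1: "pochhammer (3/2) (Suc n)
      = (3/2 + of_nat j) * pochhammer (3/2) j * pochhammer (3/2 + of_nat (Suc j) :: 'a) m" .
    have "pochhammer (1/2 - of_nat j) n = pochhammer (1/2 - of_nat j) j * pochhammer (1/2 :: 'a) m"
      using pochhammer_product'[of "1/2 - of_nat j :: 'a" j m] by (simp add: n)
    also have "pochhammer (1/2 - of_nat j) j = (-1)^j * pochhammer (1/2 :: 'a) j"
      using pochhammer_minus[of "-1/2 + of_nat j :: 'a" j] by (simp add: algebra_simps)
    finally have 2: "pochhammer (1/2 - of_nat j) n
      = (-1)^j * pochhammer (1/2) j * pochhammer (1/2 :: 'a) m" .
    have 3: "of_nat (n choose j) = (fact n / (fact j * fact m) :: 'a)"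
      by (subst binomial_fact) (simp_all add: n)
    have s: "(-1)^j * (-1)^j = (1::'a)"
      by (simp flip: power_mult_distrib)
    have "(-1)^j * of_nat (n choose j) * (pochhammer (1/2 - of_nat j) n / (3/2 + of_nat j))
      = ((-1)^j * (-1)^j) * (fact n / (fact j * fact m)
          * (pochhammer (1/2) j * pochhammer (1/2 :: 'a) m / (3/2 + of_nat j)))"
      unfolding 2 3 by (simp add: mult_ac)
    then show ?thesis
      unfolding s 1 sqrt_coeff_def using nz by simp
  qed
  finally show ?thesis by (simp add: m_def)
qed

text \<open>
  This says that the square of the series built from \<open>sqrt_coeff\<close> has coefficients \<open>(n+1)!\<close>. The
  indices \<open>p\<close> and \<open>j = n - p - k\<close> belong to the two factors, and \<open>k\<close> counts the derivatives that
  the odd power \<open>y\<^sup>2\<^sup>p\<^sup>+\<^sup>1\<close> of the left factor applies to the right one.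
\<close>

lemma sqrt_coeff_convolution:
  "(\<Sum>p\<le>n. \<Sum>k\<le>n-p. sqrt_coeff p * sqrt_coeff (n - p - k)
      * (pochhammer (of_nat p + 1/2) k / fact k) * pochhammer (of_nat (n - p - k) + 1) k)
   = (fact (Suc n) :: 'a::field_char_0)"
proof -
  let ?f = "\<lambda>p k j. sqrt_coeff p * sqrt_coeff j * (pochhammer (of_nat p + 1/2) k / fact k)
      * pochhammer (of_nat j + 1) k :: 'a"
  note nz = three_halves_add_of_nat_nonzero[where 'a = 'a]
  have nzp: "pochhammer (3/2) (Suc n) \<noteq> (0::'a)"
    using nz by (auto simp: pochhammer_eq_0_iff add_eq_0_iff2)
  have "(\<Sum>p\<le>n. \<Sum>k\<le>n-p. ?f p k (n - p - k)) = (\<Sum>j\<le>n. \<Sum>p\<le>n-j. ?f p (n - j - p) j)"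
    unfolding sum.Sigma[OF finite_atMost ballI[OF finite_atMost]]
    by (rule sum.reindex_bij_witness[where i = "\<lambda>(j, p). (p, n - j - p)" and j = "\<lambda>(p, k). (n - p - k, p)"]) auto
  also have "\<dots> = (\<Sum>j\<le>n. (pochhammer (3/2) (Suc n) / fact n) * ((-1)^j * of_nat (n choose j)
           * (pochhammer (1/2 - of_nat j) n / (3/2 + of_nat j))))"
    using sqrt_coeff_fixed_right[where 'a = 'a] by (intro sum.cong refl) simp
  also have "\<dots> = (pochhammer (3/2) (Suc n) / fact n) * (fact n * pochhammer (1/2 + 3/2) n / pochhammer (3/2) (Suc n))"
    unfolding sum_distrib_left[symmetric] using pochhammer_partial_fractions[OF nz, of n n "1/2"] by simp
  also have "\<dots> = pochhammer 2 n"
    using nzp by simp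
  also have "\<dots> = fact (Suc n)"
    using pochhammer_rec[of "1::'a" n] by (simp only: pochhammer_fact) simp
  finally show ?thesis .
qed

section \<open>Coefficients of explicit Laurent series\<close>

lemma laurent_sum_nth:
  assumes "inj e"
  shows "laurent_sum e h $$ int (e n) = h n"
    and "(\<And>n. int (e n) \<noteq> m) \<Longrightarrow> laurent_sum e h $$ m = 0"
proof -
  have "{n. int (e n) = m} = {}" if "m < 0" for m
    using that by auto
  then have "\<forall>m<0. (\<Sum>n | int (e n) = m. h n) = 0"
    by simp
  then have nth: "laurent_sum e h $$ m = (\<Sum>n | int (e n) = m. h n)" for m
    unfolding laurent_sum_def by (rule nth_Abs_fls_lower_bound)
  have "{k. int (e k) = int (e n)} = {n}"
    using assms by (auto dest: injD)
  then show "laurent_sum e h $$ int (e n) = h n"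
    unfolding nth by simp
  show "laurent_sum e h $$ m = 0" if "\<And>n. int (e n) \<noteq> m"
    unfolding nth using that by simp
qed

section \<open>Derivations over a field of constants\<close>

text \<open>
  The part of the structure of the algebra of functions that the computations with series use: a
  derivation \<open>der\<close> that kills an embedded field \<open>scal\<close> of constants of characteristic zero.
\<close>

locale differential_algebra =
  fixes scal :: "'k::field_char_0 \<Rightarrow> 'r::idom" and der :: "'r \<Rightarrow> 'r"
  assumes scal_add: "scal (a + b) = scal a + scal b"
    and scal_mult: "scal (a * b) = scal a * scal b"
    and scal_one: "scal 1 = 1"
    and der_add: "der (f + g) = der f + der g"
    and der_mult: "der (f * g) = der f * g + f * der g"
    and der_scal: "der (scal a) = 0"
begin

lemma scal_0 [simp]: "scal 0 = 0"
  using scal_add[of 0 0] by (metis add_0 add_cancel_right_right)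

lemma scal_minus: "scal (- a) = - scal a"
  using scal_add[of a "- a"] by (simp add: eq_neg_iff_add_eq_0 add.commute)

lemma scal_sum: "scal (sum h A) = (\<Sum>x\<in>A. scal (h x))"
  by (induction A rule: infinite_finite_induct) (simp_all add: scal_add)

lemma scal_power: "scal (a ^ n) = scal a ^ n"
  by (induction n) (simp_all add: scal_one scal_mult)

lemma scal_of_nat: "scal (of_nat n) = of_nat n"
  by (induction n) (simp_all add: scal_one scal_add)

lemma scal_eq_0_iff [simp]: "scal a = 0 \<longleftrightarrow> a = 0"
proof
  assume "scal a = 0"
  show "a = 0"
  proof (rule ccontr)
    assume "a \<noteq> 0"
    then have "scal a * scal (inverse a) = 1"
      by (simp flip: scal_mult add: scal_one)
    then show False using \<open>scal a = 0\<close> by simp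
  qed
qed simp

lemma der_0 [simp]: "der 0 = 0"
  using der_add[of 0 0] by (metis add_0 add_cancel_right_right)

lemma der_one [simp]: "der 1 = 0"
  using der_scal[of 1] by (simp add: scal_one)

lemma der_sum: "der (sum h A) = (\<Sum>x\<in>A. der (h x))"
  by (induction A rule: infinite_finite_induct) (simp_all add: der_add)

lemma der_scal_mult: "der (scal a * f) = scal a * der f"
  by (simp add: der_mult der_scal)

lemma der_pow_0 [simp]: "(der ^^ k) 0 = 0"
  by (induction k) simp_all

lemma der_pow_one: "(der ^^ k) 1 = (if k = 0 then 1 else 0)"
  by (cases k) (simp_all add: funpow_swap1)

lemma der_pow_add: "(der ^^ k) (f + g) = (der ^^ k) f + (der ^^ k) g"
  by (induction k) (simp_all add: der_add)

lemma der_pow_sum: "(der ^^ k) (sum h A) = (\<Sum>x\<in>A. (der ^^ k) (h x))"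
  by (induction k) (simp_all add: der_sum)

lemma der_pow_scal_mult: "(der ^^ k) (scal a * f) = scal a * (der ^^ k) f"
  by (induction k) (simp_all add: der_scal_mult)

lemma funpow_scal_der: "((\<lambda>f. scal b * der f) ^^ k) f = scal (b ^ k) * (der ^^ k) f"
  by (induction k) (simp_all add: scal_one scal_mult der_scal_mult mult.assoc)

lemma leibniz: "(der ^^ n) (f * g) = (\<Sum>k\<le>n. of_nat (n choose k) * (der ^^ k) f * (der ^^ (n - k)) g)"
proof (induction n arbitrary: f g)
  case 0
  then show ?case by simp
next
  case (Suc n)
  let ?t = "\<lambda>n k. of_nat (n choose k) * (der ^^ k) f * (der ^^ (Suc n - k)) g"
  have "(der ^^ Suc n) (f * g) = (der ^^ n) (der f * g) + (der ^^ n) (f * der g)"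
    by (simp add: funpow_Suc_right der_mult der_pow_add del: funpow.simps)
  also have "(der ^^ n) (der f * g)
      = (\<Sum>k\<le>n. of_nat (n choose k) * (der ^^ Suc k) f * (der ^^ (n - k)) g)"
    by (simp add: Suc.IH funpow_Suc_right del: funpow.simps)
  also have "(der ^^ n) (f * der g)
      = (\<Sum>k\<le>Suc n. of_nat (n choose k) * (der ^^ k) f * (der ^^ (Suc n - k)) g)"
    unfolding Suc.IH
    by (simp add: binomial_eq_0 del: funpow.simps)
       (auto intro!: sum.cong simp: Suc_diff_le funpow_Suc_right simp del: funpow.simps)
  finally show ?case
    by (simp add: sum.atMost_Suc_shift sum.distrib algebra_simps del: sum.atMost_Suc funpow.simps)
qed

lemma der_inverse:
  assumes "f * v = 1" "der f = scal c"
  shows "der v = - (scal c * v ^ 2)"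
proof -
  have "scal c * v + f * der v = 0"
    using der_mult[of f v] assms by simp
  then have dv: "f * der v = - (scal c * v)"
    by (metis add_eq_0_iff)
  have "der v = (f * v) * der v"
    by (simp only: assms(1) mult_1_left)
  also have "\<dots> = v * (f * der v)"
    by (simp only: mult_ac)
  also have "\<dots> = - (scal c * v ^ 2)"
    by (simp only: dv power2_eq_square mult_minus_right mult.left_commute)
  finally show ?thesis .
qed

section \<open>Left multiplication by powers of the variable\<close>

text \<open>
  Let \<open>\<sigma>\<close> be the shift of exponents by one. This is the operator
  \<open>\<sigma>\<^sup>i (1 + der \<sigma>\<^sup>s)\<^sup>e\<close>, expanded by the binomial series; \<open>der\<close> acts on coefficients and commutes with
  \<open>\<sigma>\<close>. The bound on \<open>k\<close> discards only terms that involve coefficients below the valuation of \<open>G\<close>.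
\<close>

definition binomial_shift :: "nat \<Rightarrow> 'k \<Rightarrow> int \<Rightarrow> 'r fls \<Rightarrow> 'r fls" where
  "binomial_shift s e i G = Abs_fls (\<lambda>m. \<Sum>k\<le>nat (m - i - fls_subdegree G).
     scal (e gchoose k) * (der ^^ k) (G $$ (m - i - int s * int k)))"

text \<open>
  Any bound beyond the last nonzero term may be used, which makes the sums for different arguments
  comparable. The lower bound \<open>q\<close> stands in for the valuation, since the valuation of a sum may
  exceed those of its summands.
\<close>

lemma binomial_shift_nth:
  assumes s: "s > 0" and q: "\<And>l. l < q \<Longrightarrow> G $$ l = 0" and N: "m - i - q \<le> int N"
  shows "binomial_shift s e i G $$ m
       = (\<Sum>k\<le>N. scal (e gchoose k) * (der ^^ k) (G $$ (m - i - int s * int k)))"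
proof -
  let ?h = "\<lambda>m k. scal (e gchoose k) * (der ^^ k) (G $$ (m - i - int s * int k))"
  have zero: "?h m k = 0" if "\<And>l. l < p \<Longrightarrow> G $$ l = 0" "m - i - p < int k" for m p k
  proof -
    have "int k \<le> int s * int k"
      using s by (simp add: mult_le_cancel_right1)
    with that(2) have "m - i - int s * int k < p" by linarith
    then show ?thesis using that(1) by simp
  qed
  have "(\<Sum>k\<le>nat (m - i - fls_subdegree G). ?h m k) = 0" if "m < i + fls_subdegree G" for m
    using that by (intro sum.neutral ballI zero[of "fls_subdegree G"]) auto
  then have "binomial_shift s e i G $$ m = (\<Sum>k\<le>nat (m - i - fls_subdegree G). ?h m k)"
    unfolding binomial_shift_def by (intro nth_Abs_fls_lower_bound) blast
  also have "\<dots> = (\<Sum>k\<le>max N (nat (m - i - fls_subdegree G)). ?h m k)"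
    by (intro sum.mono_neutral_left ballI zero[of "fls_subdegree G"]) auto
  also have "\<dots> = (\<Sum>k\<le>N. ?h m k)"
    using N q by (intro sum.mono_neutral_right ballI zero[of q]) auto
  finally show ?thesis .
qed

lemma binomial_shift_eq0:
  assumes "s > 0" "\<And>l. l < q \<Longrightarrow> G $$ l = 0" "m < i + q"
  shows "binomial_shift s e i G $$ m = 0"
  using binomial_shift_nth[where q = q and G = G and m = m and N = 0] assms by simp

lemma binomial_shift_leading:
  assumes "s > 0" "\<And>l. l < q \<Longrightarrow> G $$ l = 0"
  shows "binomial_shift s e i G $$ (i + q) = G $$ q"
  using binomial_shift_nth[where q = q and G = G and m = "i + q" and N = 0] assms by (simp add: scal_one)

lemma binomial_shift_add:
  assumes s: "s > 0"
  shows "binomial_shift s e i (F + G) = binomial_shift s e i F + binomial_shift s e i G"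
proof (rule fls_eqI)
  fix m
  define q where "q = min (fls_subdegree F) (fls_subdegree G)"
  have "F $$ l = 0" "G $$ l = 0" if "l < q" for l
    using that by (simp_all add: q_def)
  then show "binomial_shift s e i (F + G) $$ m = (binomial_shift s e i F + binomial_shift s e i G) $$ m"
    using s by (simp add: binomial_shift_nth[where q = q and N = "nat (m - i - q)"] der_pow_add
        algebra_simps sum.distrib)
qed

text \<open>
  Exponents add because all operators involved commute; on coefficients this is Vandermonde's
  identity. Hence these operators are invertible, and their integer powers, which are used
  in the definition of the skew product, are of the same form.
\<close>

lemma binomial_shift_binomial_shift:
  assumes s: "s > 0"
  shows "binomial_shift s e i (binomial_shift s e' j G) = binomial_shift s (e + e') (i + j) G"
proof (rule fls_eqI)
  fix m
  define q where "q = fls_subdegree G"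
  define N where "N = nat (m - i - j - q)"
  have q: "G $$ l = 0" if "l < q" for l
    using that by (simp add: q_def)
  let ?t = "\<lambda>k l. scal ((e gchoose k) * (e' gchoose l)) * (der ^^ (k + l)) (G $$ (m - (i + j) - int s * int (k + l)))"
  have inner: "binomial_shift s e' j G $$ (m - i - int s * int k)
      = (\<Sum>l\<le>N-k. scal (e' gchoose l) * (der ^^ l) (G $$ (m - (i + j) - int s * int (k + l))))" if "k \<le> N" for k
  proof -
    have "int k \<le> int s * int k"
      using s by (simp add: mult_le_cancel_right1)
    then have "m - i - int s * int k - j - q \<le> int (N - k)"
      using that unfolding N_def by linarith
    from binomial_shift_nth[OF s q this] show ?thesis
      by (simp add: algebra_simps)
  qed
  have "binomial_shift s e i (binomial_shift s e' j G) $$ m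
      = (\<Sum>k\<le>N. scal (e gchoose k) * (der ^^ k) (binomial_shift s e' j G $$ (m - i - int s * int k)))"
    by (intro binomial_shift_nth[where q = "j + q"] s binomial_shift_eq0[of s q] q) (auto simp: N_def)
  also have "\<dots> = (\<Sum>k\<le>N. \<Sum>l\<le>N-k. ?t k l)"
    by (intro sum.cong refl)
       (simp add: inner der_pow_sum der_pow_scal_mult scal_mult sum_distrib_left funpow_add mult.assoc)
  also have "\<dots> = (\<Sum>n\<le>N. \<Sum>k\<le>n. ?t k (n - k))"
    unfolding sum.Sigma[OF finite_atMost ballI[OF finite_atMost]]
    by (rule sum.reindex_bij_witness[where i = "\<lambda>(n, k). (k, n - k)" and j = "\<lambda>(k, l). (k + l, k)"]) auto
  also have "\<dots> = (\<Sum>n\<le>N. scal (\<Sum>k\<le>n. (e gchoose k) * (e' gchoose (n - k)))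
      * (der ^^ n) (G $$ (m - (i + j) - int s * int n)))"
    by (simp add: scal_sum sum_distrib_right)
  also have "\<dots> = (\<Sum>n\<le>N. scal ((e + e') gchoose n) * (der ^^ n) (G $$ (m - (i + j) - int s * int n)))"
    by (simp add: gbinomial_Vandermonde[of e e', unfolded atLeast0AtMost])
  also have "\<dots> = binomial_shift s (e + e') (i + j) G $$ m"
    by (rule binomial_shift_nth[OF s, where q = q, symmetric]) (use q in \<open>auto simp: N_def\<close>)
  finally show "binomial_shift s e i (binomial_shift s e' j G) $$ m
      = binomial_shift s (e + e') (i + j) G $$ m" .
qed

lemma binomial_shift_0:
  assumes "s > 0"
  shows "binomial_shift s 0 0 G = G"
proof (rule fls_eqI)
  fix m
  let ?N = "nat (m - fls_subdegree G)"
  have "binomial_shift s 0 0 G $$ m = (\<Sum>k\<le>?N. scal (0 gchoose k) * (der ^^ k) (G $$ (m - 0 - int s * int k)))"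
    using assms by (intro binomial_shift_nth[where q = "fls_subdegree G"]) auto
  also have "\<dots> = (\<Sum>k\<in>{0}. scal (0 gchoose k) * (der ^^ k) (G $$ (m - 0 - int s * int k)))"
    by (intro sum.mono_neutral_right) (auto simp: gbinomial_0_left)
  finally show "binomial_shift s 0 0 G $$ m = G $$ m"
    by (simp add: scal_one)
qed

lemma inv_binomial_shift:
  assumes "s > 0"
  shows "inv (binomial_shift s e i) = binomial_shift s (- e) (- i)"
  using assms by (intro inv_equality) (simp_all add: binomial_shift_binomial_shift binomial_shift_0)

lemma funpow_binomial_shift:
  assumes "s > 0"
  shows "binomial_shift s e i ^^ n = binomial_shift s (of_nat n * e) (int n * i)"
proof (rule ext)
  fix G
  show "(binomial_shift s e i ^^ n) G = binomial_shift s (of_nat n * e) (int n * i) G"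
    using assms by (induction n) (simp_all add: binomial_shift_binomial_shift binomial_shift_0 algebra_simps)
qed

lemma int_iterate_binomial_shift:
  assumes "s > 0"
  shows "int_iterate (binomial_shift s e 1) i = binomial_shift s (of_int i * e) i"
  using assms
  by (cases "i \<ge> 0") (simp_all add: int_iterate_def inv_binomial_shift funpow_binomial_shift)

text \<open>
  Identifies multiplication by the variable \<open>w\<close> with a binomial series, for a commutation rule
  given in terms of a multiple \<open>b der\<close> of the derivation.
\<close>

lemma lmul_gen_eq_binomial_shift:
  assumes s: "s > 0" and D: "D = (\<lambda>f. scal b * der f)"
    and a: "\<And>k. a k * scal (b ^ k) = scal (e gchoose k)"
  shows "lmul_gen s a D = binomial_shift s e 1"
proof (intro ext fls_eqI)
  fix G m
  have "lmul_gen s a D G $$ m = (\<Sum>k\<le>nat (m - fls_subdegree G).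
      scal (e gchoose k) * (der ^^ k) (G $$ (m - 1 - int s * int k)))"
    unfolding D by (subst lmul_gen_nth) (simp_all only: funpow_scal_der a[symmetric] mult.assoc diff_diff_eq
        der_0 mult_zero_right)
  also have "\<dots> = binomial_shift s e 1 G $$ m"
    by (rule binomial_shift_nth[OF s, symmetric, where q = "fls_subdegree G"]) auto
  finally show "lmul_gen s a D G $$ m = binomial_shift s e 1 G $$ m" .
qed

section \<open>Products of skew Laurent series\<close>

lemma skew_mult_nth:
  assumes s: "s > 0" and p: "\<And>l. l < p \<Longrightarrow> F $$ l = 0" and q: "\<And>l. l < q \<Longrightarrow> G $$ l = 0"
  shows "skew_mult (binomial_shift s e 1) F G $$ m
       = (\<Sum>i=p..m-q. F $$ i * binomial_shift s (of_int i * e) i G $$ m)"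
proof -
  let ?h = "\<lambda>m i. F $$ i * binomial_shift s (of_int i * e) i G $$ m"
  have zero: "?h m i = 0"
    if "i \<notin> {p'..m-q'}" "\<And>l. l < p' \<Longrightarrow> F $$ l = 0" "\<And>l. l < q' \<Longrightarrow> G $$ l = 0" for m i p' q'
  proof (cases "i < p'")
    case False
    with that(1) have "m < i + q'" by auto
    then show ?thesis
      using binomial_shift_eq0[where q = q' and G = G] s that(3) by simp
  qed (simp add: that(2))
  have "\<forall>m < fls_subdegree F + fls_subdegree G.
      (\<Sum>i=fls_subdegree F..m - fls_subdegree G. ?h m i) = 0"
    by simp
  then have "skew_mult (binomial_shift s e 1) F G $$ m = (\<Sum>i=fls_subdegree F..m - fls_subdegree G. ?h m i)"
    unfolding skew_mult_def int_iterate_binomial_shift[OF s] by (rule nth_Abs_fls_lower_bound)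
  also have "\<dots> = (\<Sum>i=min p (fls_subdegree F)..max (m - q) (m - fls_subdegree G). ?h m i)"
    by (intro sum.mono_neutral_left ballI zero[of _ "fls_subdegree F" _ "fls_subdegree G"]) auto
  also have "\<dots> = (\<Sum>i=p..m-q. ?h m i)"
    by (intro sum.mono_neutral_right ballI zero[of _ p _ q]) (auto intro: p q)
  finally show ?thesis .
qed

text \<open>
  The rule \<open>w f = f w + \<dots>\<close> does not affect terms of lowest degree, so they multiply as in a
  commutative ring.
\<close>

lemma skew_mult_leading:
  assumes "s > 0" "\<And>l. l < p \<Longrightarrow> F $$ l = 0" "\<And>l. l < q \<Longrightarrow> G $$ l = 0"
  shows "skew_mult (binomial_shift s e 1) F G $$ (p + q) = F $$ p * G $$ q"
  using skew_mult_nth[where p = p and q = q and F = F and G = G and m = "p + q"]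
    binomial_shift_leading[where q = q and G = G] assms
  by simp

lemma skew_mult_add_left:
  assumes "s > 0"
  shows "skew_mult (binomial_shift s e 1) (F + F') G
       = skew_mult (binomial_shift s e 1) F G + skew_mult (binomial_shift s e 1) F' G"
proof (rule fls_eqI)
  fix m
  define p where "p = min (fls_subdegree F) (fls_subdegree F')"
  have "F $$ l = 0" "F' $$ l = 0" if "l < p" for l
    using that by (simp_all add: p_def)
  then show "skew_mult (binomial_shift s e 1) (F + F') G $$ m
      = (skew_mult (binomial_shift s e 1) F G + skew_mult (binomial_shift s e 1) F' G) $$ m"
    using assms
    by (simp add: skew_mult_nth[where p = p and q = "fls_subdegree G"] distrib_right sum.distrib)
qed

lemma skew_mult_add_right:
  assumes "s > 0"
  shows "skew_mult (binomial_shift s e 1) F (G + G')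
       = skew_mult (binomial_shift s e 1) F G + skew_mult (binomial_shift s e 1) F G'"
proof (rule fls_eqI)
  fix m
  define q where "q = min (fls_subdegree G) (fls_subdegree G')"
  have "G $$ l = 0" "G' $$ l = 0" if "l < q" for l
    using that by (simp_all add: q_def)
  then show "skew_mult (binomial_shift s e 1) F (G + G') $$ m
      = (skew_mult (binomial_shift s e 1) F G + skew_mult (binomial_shift s e 1) F G') $$ m"
    using assms
    by (simp add: skew_mult_nth[where q = q and p = "fls_subdegree F"] binomial_shift_add
        distrib_left sum.distrib)
qed

text \<open>
  If \<open>S\<close> and \<open>S'\<close> have equal squares, \<open>\<Delta> = S - S'\<close> satisfies \<open>S \<Delta> + \<Delta> S' = 0\<close>. The lowest term of the
  left side has twice the product of the leading coefficients of \<open>S\<close> and \<open>\<Delta>\<close> as its coefficient,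
  which is nonzero in a domain of characteristic zero unless \<open>\<Delta> = 0\<close>.
\<close>

lemma skew_square_root_unique:
  assumes s: "s > 0"
    and sq: "skew_mult (binomial_shift s e 1) S S = skew_mult (binomial_shift s e 1) S' S'"
    and p: "fls_subdegree S = p" "fls_subdegree S' = p" and lead: "S $$ p = S' $$ p" "S $$ p \<noteq> 0"
  shows "S = S'"
proof (rule ccontr)
  let ?mult = "skew_mult (binomial_shift s e 1)"
  define \<Delta> where "\<Delta> = S - S'"
  define q where "q = fls_subdegree \<Delta>"
  assume "S \<noteq> S'"
  then have \<Delta>: "\<Delta> $$ q \<noteq> 0"
    unfolding q_def by (intro nth_fls_subdegree_nonzero) (simp add: \<Delta>_def)
  have low: "S $$ l = 0" "S' $$ l = 0" if "l < p" for l
    using that p by auto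
  have lowq: "\<Delta> $$ l = 0" if "l < q" for l
    using that by (simp add: q_def)
  have S: "S = \<Delta> + S'"
    by (simp add: \<Delta>_def)
  have "?mult S S = ?mult S \<Delta> + ?mult S S'"
    using skew_mult_add_right[OF s, of e S \<Delta> S'] S by simp
  also have "?mult S S' = ?mult \<Delta> S' + ?mult S' S'"
    using skew_mult_add_left[OF s, of e \<Delta> S' S'] S by simp
  finally have "(?mult S \<Delta> + ?mult \<Delta> S') $$ (p + q) = 0"
    using sq by simp
  moreover have "?mult S \<Delta> $$ (p + q) = S $$ p * \<Delta> $$ q"
    using s low lowq by (intro skew_mult_leading) auto
  moreover have "?mult \<Delta> S' $$ (q + p) = \<Delta> $$ q * S' $$ p"
    using s low lowq by (intro skew_mult_leading) auto
  ultimately have "scal 2 * (S $$ p * \<Delta> $$ q) = 0"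
    using lead scal_of_nat[of 2] by (simp add: add.commute mult.commute)
  then show False
    using lead \<Delta> by simp
qed

lemma skew_mult_one_right:
  assumes s: "s > 0"
  shows "skew_mult (binomial_shift s e 1) F 1 = F"
proof (rule fls_eqI)
  fix m
  have 1: "binomial_shift s e' i 1 $$ m = (if m = i then 1 else 0)" for e' i
  proof -
    have "binomial_shift s e' i 1 $$ m = (\<Sum>k\<le>nat (m - i). scal (e' gchoose k) * (der ^^ k) (1 $$ (m - i - int s * int k)))"
      using s by (intro binomial_shift_nth[where q = 0]) auto
    also have "\<dots> = (\<Sum>k\<in>{0}. scal (e' gchoose k) * (der ^^ k) (1 $$ (m - i - int s * int k)))"
      by (intro sum.mono_neutral_right) (auto simp: der_pow_one)
    finally show ?thesis
      by (simp add: scal_one)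
  qed
  let ?p = "min m (fls_subdegree F)"
  have "skew_mult (binomial_shift s e 1) F 1 $$ m
      = (\<Sum>i=?p..m-0. F $$ i * binomial_shift s (of_int i * e) i 1 $$ m)"
    using s by (intro skew_mult_nth) auto
  also have "\<dots> = (\<Sum>i=?p..m. if m = i then F $$ i else 0)"
    by (simp add: 1 if_distrib cong: if_cong)
  also have "\<dots> = F $$ m"
    by simp
  finally show "skew_mult (binomial_shift s e 1) F 1 $$ m = F $$ m" .
qed

lemma skew_mult_const_left:
  assumes s: "s > 0"
  shows "skew_mult (binomial_shift s e 1) (fls_const g) G = fls_const g * G"
proof (rule fls_eqI)
  fix m
  let ?q = "min m (fls_subdegree G)"
  have "skew_mult (binomial_shift s e 1) (fls_const g) G $$ m
      = (\<Sum>i=0..m-?q. fls_const g $$ i * binomial_shift s (of_int i * e) i G $$ m)"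
    using s by (intro skew_mult_nth) auto
  also have "\<dots> = (\<Sum>i\<in>{0}. fls_const g $$ i * binomial_shift s (of_int i * e) i G $$ m)"
    by (intro sum.mono_neutral_right) auto
  finally show "skew_mult (binomial_shift s e 1) (fls_const g) G $$ m = (fls_const g * G) $$ m"
    using s by (simp add: binomial_shift_0)
qed

lemma binomial_shift_monomial:
  assumes H: "\<And>l. H $$ l = (if l = j then g else 0)"
  shows "binomial_shift 1 e i H $$ m = (if m < i + j then 0
           else scal (e gchoose nat (m - i - j)) * (der ^^ nat (m - i - j)) g)"
proof (cases "m < i + j")
  case True
  then show ?thesis
    using binomial_shift_eq0[of 1 j H m i] H by simp
next
  case False
  let ?N = "nat (m - i - j)"
  have "binomial_shift 1 e i H $$ m = (\<Sum>k\<le>?N. scal (e gchoose k) * (der ^^ k) (H $$ (m - i - int 1 * int k)))"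
    using H by (intro binomial_shift_nth[where q = j]) auto
  also have "\<dots> = (\<Sum>k\<in>{?N}. scal (e gchoose k) * (der ^^ k) (H $$ (m - i - int 1 * int k)))"
    by (intro sum.mono_neutral_right) (auto simp: H)
  finally show ?thesis
    using False by (simp add: H)
qed

text \<open>
  In \<open>B\<close>, with \<open>w\<close> the variable, the inverse of \<open>g w\<^sup>-\<^sup>1\<close> is \<open>w h\<close>. Left multiplication by the
  former is \<open>g\<close> times an invertible operator, so a right inverse is unique and equal to
  \<open>w h\<close>. That it is also a left inverse is the relation \<open>(w h) (g w\<^sup>-\<^sup>1) = w (h g) w\<^sup>-\<^sup>1 = 1\<close>; its
  coefficient of degree \<open>n\<close> is a multiple of the \<open>n\<close>-th derivative of \<open>h g = 1\<close> by Leibniz' rule.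
\<close>

lemma skew_inverse_const_X_inv:
  assumes gh: "g * h = 1"
  defines "T \<equiv> binomial_shift 1 (-1) 1"
  shows "skew_inverse T (skew_mult T (fls_const g) fls_X_inv) = T (fls_const h)"
proof -
  define F where "F = skew_mult T (fls_const g) fls_X_inv"
  have hg: "h * g = 1"
    using gh by (simp only: mult.commute)
  have F: "F $$ l = (if l = -1 then g else 0)" for l
    unfolding F_def T_def by (simp add: skew_mult_const_left)
  \<comment> \<open>\<open>F\<close> is a single term, so \<open>F G\<close> is \<open>g\<close> times the inverse of left multiplication by the variable.\<close>
  have left: "skew_mult T F G = fls_const g * binomial_shift 1 1 (-1) G" for G
  proof (rule fls_eqI)
    fix m
    let ?q = "min (m + 1) (fls_subdegree G)"
    have "skew_mult T F G $$ m = (\<Sum>i=-1..m-?q. F $$ i * binomial_shift 1 (of_int i * (-1)) i G $$ m)"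
      unfolding T_def by (intro skew_mult_nth) (auto simp: F)
    also have "\<dots> = (\<Sum>i\<in>{-1}. F $$ i * binomial_shift 1 (of_int i * (-1)) i G $$ m)"
      by (intro sum.mono_neutral_right) (auto simp: F)
    finally show "skew_mult T F G $$ m = (fls_const g * binomial_shift 1 1 (-1) G) $$ m"
      by (simp add: F)
  qed
  have unique: "G = T (fls_const h)" if "skew_mult T F G = 1" for G
  proof -
    have "binomial_shift 1 1 (-1) G = fls_const h * (fls_const g * binomial_shift 1 1 (-1) G)"
      by (simp only: mult.assoc[symmetric] fls_const_mult_const hg) simp
    also have "\<dots> = fls_const h"
      using that left by simp
    finally show ?thesis
      unfolding T_def using binomial_shift_binomial_shift[of 1 "-1" 1 1 "-1" G] by (simp add: binomial_shift_0)
  qed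
  have FT: "skew_mult T F (T (fls_const h)) = 1"
    unfolding left unfolding T_def
    using gh by (simp add: binomial_shift_binomial_shift binomial_shift_0 fls_const_mult_const)
  have TF: "skew_mult T (T (fls_const h)) F = 1"
  proof (rule fls_eqI)
    fix m
    have Th: "T (fls_const h) $$ i = (if i < 1 then 0
        else scal (- 1 gchoose nat (i - 1)) * (der ^^ nat (i - 1)) h)" for i
      unfolding T_def using binomial_shift_monomial[of "fls_const h" 0 h] by simp
    have "skew_mult T (T (fls_const h)) F $$ m
        = (\<Sum>i=1..m-(-1). T (fls_const h) $$ i * binomial_shift 1 (of_int i * (-1)) i F $$ m)"
      unfolding T_def by (intro skew_mult_nth) (use Th F in \<open>auto simp: T_def\<close>)
    also have "\<dots> = 1 $$ m"
    proof (cases "m < 0")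
      case True
      then show ?thesis by simp
    next
      case False
      then obtain n where m: "m = int n"
        by (metis nat_0_le linorder_not_less)
      have "(\<Sum>i=1..m-(-1). T (fls_const h) $$ i * binomial_shift 1 (of_int i * (-1)) i F $$ m)
          = (\<Sum>k\<le>n. T (fls_const h) $$ (int k + 1) * binomial_shift 1 (of_int (int k + 1) * (-1)) (int k + 1) F $$ m)"
        by (rule sum.reindex_bij_witness[where i = "\<lambda>k. int k + 1" and j = "\<lambda>i. nat (i - 1)"]) (auto simp: m)
      also have "\<dots> = (\<Sum>k\<le>n. scal (- 1 gchoose n) * (of_nat (n choose k) * (der ^^ k) h * (der ^^ (n - k)) g))"
      proof (intro sum.cong refl)
        fix k assume "k \<in> {..n}"
        then have k: "k \<le> n" by simp
        then have N: "nat (m - (int k + 1) - - 1) = n - k"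
          by (simp add: m)
        have E: "of_int (int k + 1) * (- 1) = (- 1 - of_nat k :: 'k)"
          by simp
        have B: "binomial_shift 1 (of_int (int k + 1) * (-1)) (int k + 1) F $$ m
          = scal (- 1 - of_nat k gchoose (n - k)) * (der ^^ (n - k)) g"
          unfolding E binomial_shift_monomial[OF F] N using k by (simp add: m)
        have "(- 1 gchoose k) * (- 1 - of_nat k gchoose (n - k)) = (- 1 gchoose n :: 'k) * of_nat (n choose k)"
          using gbinomial_trinomial_revision[OF k, of "-1 :: 'k"] by (simp add: binomial_gbinomial)
        from arg_cong[OF this, of scal] have C: "scal (- 1 gchoose k) * scal (- 1 - of_nat k gchoose (n - k))
          = scal (- 1 gchoose n) * of_nat (n choose k)"
          by (simp only: scal_mult scal_of_nat)
        have "T (fls_const h) $$ (int k + 1) * binomial_shift 1 (of_int (int k + 1) * (-1)) (int k + 1) F $$ m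
          = (scal (- 1 gchoose k) * scal (- 1 - of_nat k gchoose (n - k))) * ((der ^^ k) h * (der ^^ (n - k)) g)"
          unfolding B Th by simp
        also note C
        finally show "T (fls_const h) $$ (int k + 1) * binomial_shift 1 (of_int (int k + 1) * (-1)) (int k + 1) F $$ m
          = scal (- 1 gchoose n) * (of_nat (n choose k) * (der ^^ k) h * (der ^^ (n - k)) g)"
          by (simp only: mult.assoc)
      qed
      also have "\<dots> = scal (- 1 gchoose n) * (der ^^ n) (h * g)"
        by (simp only: leibniz sum_distrib_left)
      also note hg
      also have "scal (- 1 gchoose n) * (der ^^ n) 1 = 1 $$ m"
        by (simp add: m der_pow_one scal_one)
      finally show ?thesis .
    qed
    finally show "skew_mult T (T (fls_const h)) F $$ m = 1 $$ m" .
  qed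
  show ?thesis
    unfolding skew_inverse_def F_def[symmetric]
    by (rule the_equality) (use FT TF unique in blast)+
qed

text \<open>
  Only the summand \<open>i = 1\<close> is present, so the inverse of \<open>S\<close>, which enters the negative
  powers, does not have to be computed.
\<close>

lemma skew_extend_X:
  assumes s: "s > 0" and \<alpha>: "\<alpha> 0 = 0" "\<alpha> 1 = 1" and S: "\<And>l. l < 1 \<Longrightarrow> S $$ l = 0"
  shows "skew_extend (binomial_shift s e 1) \<alpha> S fls_X = S"
proof -
  have "skew_powi (binomial_shift s e 1) S 1 = S"
    by (simp add: skew_powi_def skew_mult_one_right[OF s])
  then have "(\<Sum>i=1..m. \<alpha> (fls_X $$ i) * skew_powi (binomial_shift s e 1) S i $$ m) = S $$ m" for m
  proof (cases "m < 1")
    case False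
    then have "(\<Sum>i=1..m. \<alpha> (fls_X $$ i) * skew_powi (binomial_shift s e 1) S i $$ m)
        = (\<Sum>i\<in>{1}. \<alpha> (fls_X $$ i) * skew_powi (binomial_shift s e 1) S i $$ m)"
      by (intro sum.mono_neutral_right) (auto simp: \<alpha>)
    then show ?thesis
      using \<open>skew_powi (binomial_shift s e 1) S 1 = S\<close> by (simp add: \<alpha>)
  qed (use S in auto)
  then show ?thesis
    unfolding skew_extend_def by (simp add: fls_nth_inverse)
qed

section \<open>Series in the reciprocal of a linear function\<close>

lemma der_pow_power:
  assumes v: "der v = - (scal c * v ^ 2)"
  shows "(der ^^ k) (v ^ Suc j) = scal ((- c) ^ k * pochhammer (of_nat j + 1) k) * v ^ (Suc j + k)"
proof -
  have der_power: "der (v ^ n) = - (scal c * of_nat n * v ^ Suc n)" for n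
    by (induction n) (simp_all add: der_mult v algebra_simps power2_eq_square)
  show ?thesis
  proof (induction k)
    case 0
    then show ?case by (simp add: scal_one)
  next
    case (Suc k)
    let ?a = "(- c) ^ k * pochhammer (of_nat j + 1) k"
    have "(- c) ^ Suc k * pochhammer (of_nat j + 1) (Suc k) = ?a * (- c) * of_nat (Suc j + k)"
      by (simp add: pochhammer_rec' algebra_simps)
    then have A: "scal ((- c) ^ Suc k * pochhammer (of_nat j + 1) (Suc k)) = - (scal ?a * scal c * of_nat (Suc j + k))"
      by (simp only: scal_mult scal_of_nat scal_minus mult_minus_left mult_minus_right)
    have "(der ^^ Suc k) (v ^ Suc j) = scal ?a * - (scal c * of_nat (Suc j + k) * v ^ Suc (Suc j + k))"
      by (simp only: funpow.simps comp_apply Suc.IH der_scal_mult der_power)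
    then show ?case
      unfolding A add_Suc_right by (simp only: mult_minus_left mult_minus_right mult.assoc)
  qed
qed

lemma binomial_shift_inverse_square:
  assumes v: "der v = - (scal c * v ^ 2)"
  shows "binomial_shift 1 (- 1) 1 (fls_const (v ^ 2))
       = laurent_sum (\<lambda>n. n + 1) (\<lambda>n. scal (fact (n + 1) * c ^ n) * v ^ (n + 2))"
proof (rule fls_eqI)
  fix m
  have inj: "inj (\<lambda>n::nat. n + 1)"
    by (simp add: inj_def)
  have L: "binomial_shift 1 (- 1) 1 (fls_const (v ^ 2)) $$ m
      = (if m < 1 then 0 else scal (- 1 gchoose nat (m - 1)) * (der ^^ nat (m - 1)) (v ^ 2))"
    using binomial_shift_monomial[of "fls_const (v ^ 2)" 0 "v ^ 2" "- 1" 1 m] by simp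
  show "binomial_shift 1 (- 1) 1 (fls_const (v ^ 2)) $$ m
      = laurent_sum (\<lambda>n. n + 1) (\<lambda>n. scal (fact (n + 1) * c ^ n) * v ^ (n + 2)) $$ m"
  proof (cases "m < 1")
    case True
    then have "laurent_sum (\<lambda>n. n + 1) (\<lambda>n. scal (fact (n + 1) * c ^ n) * v ^ (n + 2)) $$ m = 0"
      by (intro laurent_sum_nth(2)[OF inj]) auto
    then show ?thesis
      unfolding L using True by simp
  next
    case False
    define n where "n = nat (m - 1)"
    have m: "m = int (n + 1)"
      using False by (simp add: n_def)
    have "pochhammer (2::'k) n = fact (n + 1)"
      using pochhammer_rec[of "1::'k" n] by (simp only: pochhammer_fact) simp
    moreover have "(- 1 gchoose n) = ((- 1) ^ n :: 'k)"
      by (simp add: gbinomial_pochhammer pochhammer_fact[symmetric])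
    moreover have "(- 1) ^ n * (- c) ^ n = c ^ n"
      by (simp flip: power_mult_distrib)
    ultimately have "(- 1 gchoose n) * ((- c) ^ n * pochhammer 2 n) = fact (n + 1) * c ^ n"
      by (metis mult.assoc mult.commute)
    then have "scal (- 1 gchoose n) * (der ^^ n) (v ^ 2) = scal (fact (n + 1) * c ^ n) * v ^ (n + 2)"
      using der_pow_power[OF v, of n 1]
      by (simp add: numeral_2_eq_2 flip: mult.assoc scal_mult)
    then show ?thesis
      unfolding L unfolding m by (subst laurent_sum_nth(1)[OF inj]) simp
  qed
qed

text \<open>
  With only odd exponents \<open>2p+1\<close> and a commutation rule in steps of two, the product has only even
  exponents \<open>2n+2\<close>, hence comes from \<open>B\<close>.
\<close>

lemma skew_square_odd_series:
  fixes h :: "nat \<Rightarrow> 'r"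
  defines "S \<equiv> laurent_sum (\<lambda>u. 2 * u + 1) h"
  shows "skew_mult (binomial_shift 2 e 1) S S = B_to_C (laurent_sum (\<lambda>n. n + 1)
    (\<lambda>n. \<Sum>p\<le>n. \<Sum>k\<le>n-p. h p * (scal (of_nat (2 * p + 1) * e gchoose k) * (der ^^ k) (h (n - p - k)))))"
  (is "_ = B_to_C (laurent_sum _ ?f)")
proof (rule fls_eqI)
  fix m
  have inj: "inj (\<lambda>u::nat. 2 * u + 1)" "inj (\<lambda>n::nat. n + 1)"
    by (simp_all add: inj_def)
  have S_odd: "S $$ int (2 * u + 1) = h u" for u
    unfolding S_def by (rule laurent_sum_nth(1)[OF inj(1)])
  have S_0: "S $$ l = 0" if "l < 1 \<or> even l" for l
    unfolding S_def
  proof (rule laurent_sum_nth(2)[OF inj(1)])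
    fix u show "int (2 * u + 1) \<noteq> l"
      using that by auto
  qed
  have inner_0: "binomial_shift 2 e' i S $$ m = 0" if "even (m - i)" for e' i m
  proof -
    have "binomial_shift 2 e' i S $$ m = (\<Sum>k\<le>nat (m - i - 1). scal (e' gchoose k) * (der ^^ k) (S $$ (m - i - int 2 * int k)))"
      by (rule binomial_shift_nth[where q = 1]) (auto intro: S_0)
    also have "\<dots> = 0"
      using that by (simp add: S_0)
    finally show ?thesis .
  qed
  have sq: "skew_mult (binomial_shift 2 e 1) S S $$ m
      = (\<Sum>i=1..m-1. S $$ i * binomial_shift 2 (of_int i * e) i S $$ m)"
    by (rule skew_mult_nth) (auto intro: S_0)
  show "skew_mult (binomial_shift 2 e 1) S S $$ m = B_to_C (laurent_sum (\<lambda>n. n + 1) ?f) $$ m"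
  proof (cases "even m \<and> m \<ge> 2")
    case False
    have zero: "S $$ i * binomial_shift 2 (of_int i * e) i S $$ m = 0" if "i \<in> {1..m-1}" for i
      using that False S_0[of i] inner_0[of m i] by auto
    have "skew_mult (binomial_shift 2 e 1) S S $$ m = 0"
      unfolding sq using zero by (rule sum.neutral[OF ballI])
    moreover have "B_to_C (laurent_sum (\<lambda>n. n + 1) ?f) $$ m = 0"
    proof (cases "even m")
      case True
      then have "int (n + 1) \<noteq> m div 2" for n
        using False by auto
      then have "laurent_sum (\<lambda>n. n + 1) ?f $$ (m div 2) = 0"
        by (rule laurent_sum_nth(2)[OF inj(2)])
      then show ?thesis
        by (simp add: B_to_C_def fls_nth_compose_power)
    qed (simp add: B_to_C_def fls_nth_compose_power)
    ultimately show ?thesis by simp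
  next
    case True
    define n where "n = nat (m div 2 - 1)"
    have m: "m = 2 * int n + 2"
      using True by (auto simp: n_def)
    have inner: "binomial_shift 2 e' (int (2 * p + 1)) S $$ m
        = (\<Sum>k\<le>n-p. scal (e' gchoose k) * (der ^^ k) (h (n - p - k)))" if "p \<le> n" for e' p
    proof -
      have "binomial_shift 2 e' (int (2 * p + 1)) S $$ m
          = (\<Sum>k\<le>2*(n-p). scal (e' gchoose k) * (der ^^ k) (S $$ (m - int (2 * p + 1) - int 2 * int k)))"
        by (rule binomial_shift_nth[where q = 1]) (use that in \<open>auto simp: m intro: S_0\<close>)
      also have "\<dots> = (\<Sum>k\<le>n-p. scal (e' gchoose k) * (der ^^ k) (S $$ (m - int (2 * p + 1) - int 2 * int k)))"
        using that by (intro sum.mono_neutral_right) (auto simp: m S_0)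
      also have "\<dots> = (\<Sum>k\<le>n-p. scal (e' gchoose k) * (der ^^ k) (h (n - p - k)))"
      proof (intro sum.cong refl)
        fix k assume "k \<in> {..n-p}"
        then have "m - int (2 * p + 1) - int 2 * int k = int (2 * (n - p - k) + 1)"
          using that by (simp add: m of_nat_diff)
        then show "scal (e' gchoose k) * (der ^^ k) (S $$ (m - int (2 * p + 1) - int 2 * int k))
            = scal (e' gchoose k) * (der ^^ k) (h (n - p - k))"
          by (simp only: S_odd)
      qed
      finally show ?thesis .
    qed
    have "(\<Sum>i=1..m-1. S $$ i * binomial_shift 2 (of_int i * e) i S $$ m)
        = (\<Sum>i\<in>(\<lambda>p. int (2 * p + 1)) ` {..n}. S $$ i * binomial_shift 2 (of_int i * e) i S $$ m)"
    proof (rule sum.mono_neutral_right)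
      show "\<forall>i\<in>{1..m-1} - (\<lambda>p. int (2 * p + 1)) ` {..n}. S $$ i * binomial_shift 2 (of_int i * e) i S $$ m = 0"
      proof
        fix i assume i: "i \<in> {1..m-1} - (\<lambda>p. int (2 * p + 1)) ` {..n}"
        have "even i"
        proof (rule ccontr)
          assume "odd i"
          then have "i = int (2 * nat (i div 2) + 1)" "nat (i div 2) \<le> n"
            using i by (auto simp: m elim!: oddE)
          then show False using i by blast
        qed
        then show "S $$ i * binomial_shift 2 (of_int i * e) i S $$ m = 0"
          by (simp add: S_0)
      qed
    qed (auto simp: m)
    also have "\<dots> = (\<Sum>p\<le>n. S $$ int (2 * p + 1) * binomial_shift 2 (of_int (int (2 * p + 1)) * e) (int (2 * p + 1)) S $$ m)"
      by (subst sum.reindex) (auto simp: inj_on_def)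
    also have "\<dots> = ?f n"
      by (intro sum.cong refl) (simp only: inner atMost_iff S_odd of_int_of_nat_eq sum_distrib_left)
    also have "\<dots> = laurent_sum (\<lambda>n. n + 1) ?f $$ int (n + 1)"
      by (rule laurent_sum_nth(1)[OF inj(2), symmetric])
    also have "int (n + 1) = m div 2"
      by (simp add: m)
    finally show ?thesis
      using True by (simp only: sq B_to_C_def) (simp add: fls_nth_compose_power)
  qed
qed

text \<open>
  Each summand of the square is a number times \<open>c\<^sup>n v\<^sup>n\<^sup>+\<^sup>2\<close>, because every derivative of a power of
  \<open>v\<close> contributes one factor \<open>c\<close> and one factor \<open>v\<close>. The numbers add up by
  \<open>sqrt_coeff_convolution\<close>.
\<close>

lemma skew_square_root_inverse_square:
  assumes v: "der v = - (scal c * v ^ 2)"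
  defines "S \<equiv> laurent_sum (\<lambda>u. 2 * u + 1) (\<lambda>u. scal (sqrt_coeff u * c ^ u) * v ^ (u + 1))"
  shows "skew_mult (binomial_shift 2 (- 1/2) 1) S S
       = B_to_C (laurent_sum (\<lambda>n. n + 1) (\<lambda>n. scal (fact (n + 1) * c ^ n) * v ^ (n + 2)))"
proof -
  let ?h = "\<lambda>u. scal (sqrt_coeff u * c ^ u) * v ^ (u + 1)"
  have sums: "(\<Sum>p\<le>n. \<Sum>k\<le>n-p. ?h p * (scal (of_nat (2 * p + 1) * (- 1/2) gchoose k) * (der ^^ k) (?h (n - p - k))))
      = scal (fact (n + 1) * c ^ n) * v ^ (n + 2)" for n
  proof -
    have term_eq: "?h p * (scal (of_nat (2 * p + 1) * (- 1/2) gchoose k) * (der ^^ k) (?h (n - p - k)))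
        = scal (sqrt_coeff p * sqrt_coeff (n - p - k) * (pochhammer (of_nat p + 1/2) k / fact k)
            * pochhammer (of_nat (n - p - k) + 1) k) * (scal (c ^ n) * v ^ (n + 2))"
      if "p \<le> n" "k \<le> n - p" for p k
    proof -
      define j where "j = n - p - k"
      have n: "n = p + k + j"
        using that by (simp add: j_def)
      have E: "of_nat (2 * p + 1) * (- 1/2) = - (of_nat p + 1/2 :: 'k)"
        by (simp add: field_simps)
      have G: "(of_nat (2 * p + 1) * (- 1/2) gchoose k) = (-1) ^ k * (pochhammer (of_nat p + 1/2) k / fact k :: 'k)"
        unfolding E gbinomial_pochhammer by (simp only: minus_minus times_divide_eq_right)
      have "(sqrt_coeff p * c ^ p) * (((-1) ^ k * (pochhammer (of_nat p + 1/2) k / fact k))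
          * ((sqrt_coeff j * c ^ j) * ((- c) ^ k * pochhammer (of_nat j + 1) k)))
        = sqrt_coeff p * sqrt_coeff j * (pochhammer (of_nat p + 1/2) k / fact k)
            * pochhammer (of_nat j + 1) k * (c ^ p * c ^ j * ((-1) ^ k * (-c) ^ k))"
        by (simp only: mult_ac)
      also have "(-1) ^ k * (-c) ^ k = c ^ k"
        by (simp flip: power_mult_distrib)
      also have "c ^ p * c ^ j * c ^ k = c ^ n"
        by (simp add: n power_add)
      finally have X: "scal (sqrt_coeff p * c ^ p) * (scal ((-1) ^ k * (pochhammer (of_nat p + 1/2) k / fact k))
          * (scal (sqrt_coeff j * c ^ j) * scal ((- c) ^ k * pochhammer (of_nat j + 1) k)))
        = scal (sqrt_coeff p * sqrt_coeff j * (pochhammer (of_nat p + 1/2) k / fact k)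
            * pochhammer (of_nat j + 1) k) * scal (c ^ n)"
        by (simp only: scal_mult[symmetric])
      have Y: "v ^ (p + 1) * v ^ (Suc j + k) = v ^ (n + 2)"
        by (simp add: n flip: power_add) (simp add: add_ac)
      have Z: "(a * V) * (b * (d * (e * W))) = (a * (b * (d * e))) * (V * W)" for a b d e V W :: 'r
        by (simp only: mult_ac)
      have "?h p * (scal (of_nat (2 * p + 1) * (- 1/2) gchoose k) * (der ^^ k) (?h j))
          = (scal (sqrt_coeff p * c ^ p) * v ^ (p + 1))
            * (scal ((-1) ^ k * (pochhammer (of_nat p + 1/2) k / fact k))
              * (scal (sqrt_coeff j * c ^ j)
                * (scal ((- c) ^ k * pochhammer (of_nat j + 1) k) * v ^ (Suc j + k))))"
        unfolding G der_pow_scal_mult Suc_eq_plus1[of j, symmetric] der_pow_power[OF v] ..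
      also note Z
      also note X
      also note Y
      finally show ?thesis
        unfolding j_def[symmetric] by (simp only: mult.assoc)
    qed
    have "(\<Sum>p\<le>n. \<Sum>k\<le>n-p. ?h p * (scal (of_nat (2 * p + 1) * (- 1/2) gchoose k) * (der ^^ k) (?h (n - p - k))))
      = (\<Sum>p\<le>n. \<Sum>k\<le>n-p. scal (sqrt_coeff p * sqrt_coeff (n - p - k) * (pochhammer (of_nat p + 1/2) k / fact k)
            * pochhammer (of_nat (n - p - k) + 1) k) * (scal (c ^ n) * v ^ (n + 2)))"
      by (intro sum.cong refl term_eq) (simp_all only: atMost_iff)
    also have "\<dots> = scal (\<Sum>p\<le>n. \<Sum>k\<le>n-p. sqrt_coeff p * sqrt_coeff (n - p - k)
            * (pochhammer (of_nat p + 1/2) k / fact k) * pochhammer (of_nat (n - p - k) + 1) k)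
        * (scal (c ^ n) * v ^ (n + 2))"
      by (simp only: scal_sum sum_distrib_right)
    finally show ?thesis
      unfolding sqrt_coeff_convolution by (simp only: Suc_eq_plus1 scal_mult mult.assoc)
  qed
  show ?thesis
    unfolding S_def skew_square_odd_series sums ..
qed

end

section \<open>Algebras of functions with a homographic action\<close>

context homographic_algebra
begin

text \<open>
  The exceptional set is closed in \<open>U\<close>, so identities hold on neighbourhoods and may be
  differentiated.
\<close>

lemma eventually_cosparse_nhds:
  assumes "\<forall>\<^sub>F z in cosparse U. P z"
  shows "\<forall>\<^sub>F z in cosparse U. \<forall>\<^sub>F w in nhds z. P w"
  unfolding eventually_cosparse_open_eq[OF open_U]
proof
  fix x assume "x \<in> U"
  then obtain S where S: "open S" "x \<in> S" "\<forall>y\<in>S. y \<noteq> x \<longrightarrow> P y"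
    using assms unfolding eventually_cosparse_open_eq[OF open_U] eventually_at_topological by auto
  have "\<forall>\<^sub>F w in nhds z. P w" if "z \<in> S" "z \<noteq> x" for z
  proof -
    have "\<forall>\<^sub>F w in nhds z. w \<in> S - {x}"
      using S(1) that by (intro eventually_nhds_in_open) auto
    then show ?thesis
      by (rule eventually_mono) (simp add: S(3))
  qed
  with S(1,2) show "\<forall>\<^sub>F z in at x. \<forall>\<^sub>F w in nhds z. P w"
    unfolding eventually_at_topological by (intro exI[of _ S]) simp
qed

lemma elem_eqI:
  assumes "\<forall>\<^sub>F z in cosparse U. ev f z = h z"
  shows "elem U ev h = f"
  unfolding elem_def
proof (rule the_equality)
  fix g assume "\<forall>\<^sub>F z in cosparse U. ev g z = h z"
  with assms have "\<forall>\<^sub>F z in cosparse U. ev g z = ev f z"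
    by eventually_elim simp
  then show "g = f" by (rule ev_faithful)
qed (rule assms)

lemma ev_scalar: "\<forall>\<^sub>F z in cosparse U. ev (scalar U ev k) z = k"
proof -
  obtain f where f: "\<forall>\<^sub>F z in cosparse U. ev f z = k"
    using ev_const by blast
  then show ?thesis
    using elem_eqI[OF f] by (simp add: scalar_def)
qed

lemma scalar_eqI: "\<forall>\<^sub>F z in cosparse U. ev f z = k \<Longrightarrow> scalar U ev k = f"
  unfolding scalar_def by (rule elem_eqI)

lemma partial_z_eqI:
  assumes f: "\<forall>\<^sub>F z in cosparse U. ev f z = h z"
    and h: "\<forall>\<^sub>F z in cosparse U. (h has_field_derivative ev g z) (at z)"
  shows "partial_z U ev f = g"
  unfolding partial_z_def
proof (rule the_equality)
  show g: "\<forall>\<^sub>F z in cosparse U. (ev f has_field_derivative ev g z) (at z)"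
    using eventually_cosparse_nhds[OF f] h
  proof eventually_elim
    case (elim z)
    then show ?case
      using DERIV_cong_ev[OF refl elim(1) refl] by simp
  qed
  fix g' assume "\<forall>\<^sub>F z in cosparse U. (ev f has_field_derivative ev g' z) (at z)"
  with g have "\<forall>\<^sub>F z in cosparse U. ev g' z = ev g z"
    by eventually_elim (rule DERIV_unique)
  then show "g' = g" by (rule ev_faithful)
qed

lemma ev_partial_z: "\<forall>\<^sub>F z in cosparse U. (ev f has_field_derivative ev (partial_z U ev f) z) (at z)"
proof -
  obtain g where g: "\<forall>\<^sub>F z in cosparse U. (ev f has_field_derivative ev g z) (at z)"
    using deriv_closed by blast
  have "partial_z U ev f = g"
    by (rule partial_z_eqI[OF _ g]) simp
  with g show ?thesis by simp
qed

lemma ev_zero: "\<forall>\<^sub>F z in cosparse U. ev 0 z = 0"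
  using ev_add[of 0 0] by eventually_elim simp

sublocale differential_algebra "scalar U ev" "partial_z U ev"
proof
  fix a b :: complex and f g :: 'r
  show "scalar U ev (a + b) = scalar U ev a + scalar U ev b"
    by (rule scalar_eqI)
       (use ev_add[of "scalar U ev a" "scalar U ev b"] ev_scalar[of a] ev_scalar[of b] in eventually_elim, simp)
  show "scalar U ev (a * b) = scalar U ev a * scalar U ev b"
    by (rule scalar_eqI)
       (use ev_mult[of "scalar U ev a" "scalar U ev b"] ev_scalar[of a] ev_scalar[of b] in eventually_elim, simp)
  show "scalar U ev 1 = 1"
    by (rule scalar_eqI) (rule ev_one)
  show "partial_z U ev (f + g) = partial_z U ev f + partial_z U ev g"
  proof (rule partial_z_eqI[OF ev_add])
    show "\<forall>\<^sub>F z in cosparse U. ((\<lambda>z. ev f z + ev g z) has_field_derivative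
        ev (partial_z U ev f + partial_z U ev g) z) (at z)"
      using ev_partial_z[of f] ev_partial_z[of g] ev_add[of "partial_z U ev f" "partial_z U ev g"]
      by eventually_elim (auto intro: DERIV_add)
  qed
  show "partial_z U ev (f * g) = partial_z U ev f * g + f * partial_z U ev g"
  proof (rule partial_z_eqI[OF ev_mult])
    show "\<forall>\<^sub>F z in cosparse U. ((\<lambda>z. ev f z * ev g z) has_field_derivative
        ev (partial_z U ev f * g + f * partial_z U ev g) z) (at z)"
      using ev_partial_z[of f] ev_partial_z[of g] ev_add[of "partial_z U ev f * g" "f * partial_z U ev g"]
        ev_mult[of "partial_z U ev f" g] ev_mult[of f "partial_z U ev g"]
    proof eventually_elim
      case (elim z)
      show ?case
        unfolding elim(3-5) by (rule DERIV_cong[OF DERIV_mult[OF elim(1,2)]]) (simp only: mult.commute)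
    qed
  qed
  show "partial_z U ev (scalar U ev a) = 0"
  proof (rule partial_z_eqI[OF ev_scalar])
    show "\<forall>\<^sub>F z in cosparse U. ((\<lambda>z. a) has_field_derivative ev 0 z) (at z)"
      using ev_zero by eventually_elim simp
  qed
qed

text \<open>
  As a homography of determinant one is injective, it pulls the exceptional set back to points that
  do not accumulate at \<open>z\<close>, away from its pole.
\<close>

lemma filterlim_homography:
  fixes \<gamma> :: "complex^2^2"
  assumes \<gamma>: "\<gamma> \<in> \<Gamma>" and z: "denom \<gamma> z \<noteq> 0"
  shows "filterlim (homography \<gamma>) (at (homography \<gamma> z)) (at z)"
proof -
  define a b c d where "a = \<gamma>$1$1" and "b = \<gamma>$1$2" and "c = \<gamma>$2$1" and "d = \<gamma>$2$2"
  note abcd = this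
  have det: "a * d - b * c = 1"
    using det_one[OF \<gamma>] by (simp add: det_2 abcd)
  have denom: "denom \<gamma> = (\<lambda>w. c * w + d)" and hom: "homography \<gamma> = (\<lambda>w. (a * w + b) / (c * w + d))"
    by (simp_all add: fun_eq_iff denom_def homography_def abcd)
  have z: "c * z + d \<noteq> 0"
    using z by (simp add: denom)
  have "((\<lambda>w. (a * w + b) / (c * w + d)) \<longlongrightarrow> (a * z + b) / (c * z + d)) (at z)"
    by (intro tendsto_intros z)
  moreover have "((\<lambda>w. c * w + d) \<longlongrightarrow> c * z + d) (at z)"
    by (intro tendsto_intros)
  then have "\<forall>\<^sub>F w in at z. c * w + d \<noteq> 0"
    using z by (rule tendsto_imp_eventually_ne)
  then have "\<forall>\<^sub>F w in at z. (a * w + b) / (c * w + d) \<noteq> (a * z + b) / (c * z + d)"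
    using eventually_neq_at_within[of z z UNIV]
  proof eventually_elim
    case (elim w)
    have "(a * w + b) / (c * w + d) - (a * z + b) / (c * z + d)
        = ((a * w + b) * (c * z + d) - (a * z + b) * (c * w + d)) / ((c * w + d) * (c * z + d))"
      using elim(1) z by (rule diff_frac_eq)
    also have "(a * w + b) * (c * z + d) - (a * z + b) * (c * w + d) = (w - z) * (a * d - b * c)"
      by (simp add: algebra_simps)
    also have "\<dots> = w - z"
      by (simp only: det mult_1_right)
    finally show ?case
      using elim z by auto
  qed
  ultimately show ?thesis
    by (simp add: filterlim_at hom)
qed

text \<open>
  The exceptional points of \<open>f\<close> may accumulate at infinity, so near the pole of the homography it is
  not clear that \<open>f\<cdot>\<gamma>\<close> is constant. However \<open>f\<cdot>\<gamma>\<close> is represented by an element \<open>g\<close> of the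
  algebra, and \<open>g\<close> has a derivative at all points of a punctured neighbourhood of the pole. At such
  a point \<open>g\<close> is continuous and equal to the constant on a punctured neighbourhood, hence equal to it
  at the point itself.
\<close>

lemma hom_act_const:
  fixes \<gamma> :: "complex^2^2"
  assumes \<gamma>: "\<gamma> \<in> \<Gamma>" and f: "\<forall>\<^sub>F z in cosparse U. ev f z = k"
  shows "hom_act U ev \<gamma> f = f"
proof -
  obtain g where g: "\<forall>\<^sub>F z in cosparse U. ev g z = ev f (homography \<gamma> z)"
    using homographic_closed[OF \<gamma>] by blast
  have regular: "\<forall>\<^sub>F w in at z. ev g w = k" if z: "z \<in> U" "denom \<gamma> z \<noteq> 0" for z
  proof -
    have "\<forall>\<^sub>F w in at (homography \<gamma> z). ev f w = k"
      using f U_stable[OF \<gamma> z] unfolding eventually_cosparse_open_eq[OF open_U] by blast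
    then have "\<forall>\<^sub>F w in at z. ev f (homography \<gamma> w) = k"
      using filterlim_homography[OF \<gamma> z(2)] by (rule eventually_compose_filterlim)
    moreover have "\<forall>\<^sub>F w in at z. ev g w = ev f (homography \<gamma> w)"
      using g z(1) unfolding eventually_cosparse_open_eq[OF open_U] by blast
    ultimately show ?thesis
      by eventually_elim simp
  qed
  have "\<forall>\<^sub>F w in at z. ev g w = k" if z: "z \<in> U" for z
  proof (cases "denom \<gamma> z = 0")
    case False
    with z show ?thesis by (rule regular)
  next
    case True
    have "\<gamma>$1$1 * \<gamma>$2$2 - \<gamma>$1$2 * \<gamma>$2$1 = 1"
      using det_one[OF \<gamma>] by (simp add: det_2)
    with True have c: "\<gamma>$2$1 \<noteq> 0"
      by (auto simp: denom_def)
    have "\<forall>\<^sub>F w in at z. w \<in> U"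
      using open_U z by (rule eventually_at_in_open')
    moreover have "\<forall>\<^sub>F w in at z. w \<noteq> z"
      by (rule eventually_neq_at_within)
    moreover have "\<forall>\<^sub>F w in at z. (ev g has_field_derivative ev (partial_z U ev g) w) (at w)"
      using ev_partial_z[of g] z unfolding eventually_cosparse_open_eq[OF open_U] by blast
    ultimately show ?thesis
    proof eventually_elim
      case (elim w)
      have "denom \<gamma> w = denom \<gamma> w - denom \<gamma> z"
        using True by simp
      also have "\<dots> = \<gamma>$2$1 * (w - z)"
        by (simp add: denom_def right_diff_distrib)
      finally have "denom \<gamma> w = \<gamma>$2$1 * (w - z)" .
      with c elim have "\<forall>\<^sub>F x in at w. ev g x = k"
        by (intro regular) auto
      then have "((\<lambda>_. k) \<longlongrightarrow> ev g w) (at w)"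
        using DERIV_isCont[OF elim(3)] unfolding isCont_def by (rule Lim_transform_eventually[rotated])
      then have "k = ev g w"
        by (simp add: tendsto_const_iff)
      then show "ev g w = k" ..
    qed
  qed
  then have "\<forall>\<^sub>F z in cosparse U. ev g z = k"
    unfolding eventually_cosparse_open_eq[OF open_U] by blast
  then have "g = f"
    using scalar_eqI[OF f] by (simp only: scalar_eqI)
  then show ?thesis
    unfolding hom_act_def using elem_eqI[OF g] by simp
qed

lemma lmul_x_eq_binomial_shift: "lmul_x U ev = binomial_shift 1 (- 1) 1"
proof -
  have "(- 1 gchoose k) = ((- 1) ^ k :: complex)" for k
    by (simp add: gbinomial_pochhammer pochhammer_fact[symmetric])
  then show ?thesis
    unfolding lmul_x_def
    by (intro lmul_gen_eq_binomial_shift[where b = "- 1"]) (auto simp: fun_eq_iff d_z_def scal_minus scal_one)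
qed

text \<open>
  As \<open>\<delta> = -\<partial>/2\<close>, rewriting the commutation rule in terms of \<open>\<partial>\<close> multiplies its coefficients by
  \<open>(-1/2)\<^sup>k\<close>, which makes them the binomial coefficients with upper index \<open>-1/2\<close>.
\<close>

lemma lmul_y_eq_binomial_shift: "lmul_y U ev = binomial_shift 2 (- 1/2) 1"
proof -
  have *: "fact (2 * k) / (2 ^ k * fact k ^ 2) * (- 1/2) ^ k = (- 1/2 gchoose k :: complex)" for k
  proof -
    have "fact (2 * k) = (4 ^ k * pochhammer (1/2) k * fact k :: complex)"
      by (simp add: fact_double power_mult)
    moreover have "(4 :: complex) ^ k = 2 ^ k * 2 ^ k"
      by (simp flip: power_mult_distrib)
    ultimately show ?thesis
      by (simp add: gbinomial_pochhammer power_divide power2_eq_square power_minus[of "1/2"])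
  qed
  have D: "delta_z U ev = (\<lambda>f. scalar U ev (- 1/2) * partial_z U ev f)"
    using scal_minus[of "1/2"] by (simp add: fun_eq_iff delta_z_def d_z_def)
  show ?thesis
    unfolding lmul_y_def
  proof (rule lmul_gen_eq_binomial_shift[OF _ D])
    show "scalar U ev (fact (2 * k) / (2 ^ k * (fact k)\<^sup>2)) * scalar U ev ((- 1/2) ^ k)
        = scalar U ev (- 1/2 gchoose k)" for k
      unfolding *[symmetric] by (rule scal_mult[symmetric])
  qed simp
qed

lemma denom_elem:
  fixes \<gamma> :: "complex^2^2"
  assumes \<gamma>: "\<gamma> \<in> \<Gamma>" and c: "\<gamma>$2$1 = c"
  defines "v \<equiv> elem U ev (\<lambda>z. 1 / denom \<gamma> z)"
  shows "elem U ev (denom \<gamma>) * v = 1"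
    and "partial_z U ev v = - (scalar U ev c * v ^ 2)"
    and "elem U ev (\<lambda>z. c / denom \<gamma> z) = scalar U ev c * v"
proof -
  obtain j v' where j: "\<forall>\<^sub>F z in cosparse U. ev j z = denom \<gamma> z" and v': "1 = j * v'"
    using denom_invertible[OF \<gamma>] by (blast elim: dvdE)
  have ev_v': "\<forall>\<^sub>F z in cosparse U. ev v' z = 1 / denom \<gamma> z"
    using j ev_mult[of j v'] ev_one unfolding v'[symmetric]
  proof eventually_elim
    case (elim z)
    then have "denom \<gamma> z * ev v' z = 1" by simp
    moreover from this have "denom \<gamma> z \<noteq> 0" by auto
    ultimately show ?case by (simp add: eq_divide_eq mult.commute)
  qed
  have v: "v = v'"
    unfolding v_def by (rule elem_eqI[OF ev_v'])
  have jv: "j * v = 1"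
    using v v' by simp
  have "partial_z U ev j = scalar U ev c"
  proof (rule partial_z_eqI[OF j])
    show "\<forall>\<^sub>F z in cosparse U. (denom \<gamma> has_field_derivative ev (scalar U ev c) z) (at z)"
      using ev_scalar[of "c"]
    proof eventually_elim
      case (elim z)
      show ?case
        unfolding elim denom_def[abs_def] c by (auto intro!: derivative_eq_intros)
    qed
  qed
  with jv show "partial_z U ev v = - (scalar U ev c * v ^ 2)"
    by (rule der_inverse)
  show "elem U ev (denom \<gamma>) * v = 1"
    using elem_eqI[OF j] jv by simp
  show "elem U ev (\<lambda>z. c / denom \<gamma> z) = scalar U ev c * v"
  proof (rule elem_eqI)
    show "\<forall>\<^sub>F z in cosparse U. ev (scalar U ev c * v) z = c / denom \<gamma> z"
      using ev_v' ev_mult[of "scalar U ev c" v] ev_scalar[of "c"] unfolding v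
      by eventually_elim simp
  qed
qed

lemma x_image_eq:
  fixes \<gamma> :: "complex^2^2"
  assumes \<gamma>: "\<gamma> \<in> \<Gamma>" and c: "\<gamma>$2$1 = c"
  defines "v \<equiv> elem U ev (\<lambda>z. 1 / denom \<gamma> z)"
  shows "x_image U ev \<gamma> = laurent_sum (\<lambda>n. n + 1) (\<lambda>n. scalar U ev (fact (n + 1) * c ^ n) * v ^ (n + 2))"
proof -
  note v = denom_elem[OF \<gamma> c, folded v_def]
  have "(elem U ev (denom \<gamma>)) ^ 2 * v ^ 2 = 1"
    using v(1) by (simp flip: power_mult_distrib)
  then show ?thesis
    unfolding x_image_def lmul_x_eq_binomial_shift
    by (simp only: skew_inverse_const_X_inv binomial_shift_inverse_square[OF v(2)])
qed

lemma y_image_eq: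
  fixes \<gamma> :: "complex^2^2"
  assumes \<gamma>: "\<gamma> \<in> \<Gamma>" and c: "\<gamma>$2$1 = c"
  defines "v \<equiv> elem U ev (\<lambda>z. 1 / denom \<gamma> z)"
  shows "y_image U ev \<gamma> = laurent_sum (\<lambda>u. 2 * u + 1) (\<lambda>u. scalar U ev (sqrt_coeff u * c ^ u) * v ^ (u + 1))"
    (is "_ = ?S")
proof -
  note v = denom_elem[OF \<gamma> c, folded v_def]
  have inj: "inj (\<lambda>u::nat. 2 * u + 1)"
    by (simp add: inj_def)
  have nz: "v \<noteq> 0"
    using v(1) by auto
  have S1: "?S $$ 1 = v"
  proof -
    have "?S $$ 1 = ?S $$ int (2 * 0 + 1)"
      by simp
    also have "\<dots> = scalar U ev (sqrt_coeff 0 * c ^ 0) * v ^ (0 + 1)"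
      by (rule laurent_sum_nth(1)[OF inj])
    also have "\<dots> = v"
      by (simp add: sqrt_coeff_def scal_one)
    finally show ?thesis .
  qed
  have low: "?S $$ l = 0" if "l < 1" for l
    by (rule laurent_sum_nth(2)[OF inj]) (use that in auto)
  have sub: "fls_subdegree ?S = 1"
    by (rule fls_subdegree_eqI) (use S1 nz low in auto)
  have sq: "mult_C U ev ?S ?S = B_to_C (x_image U ev \<gamma>)"
    unfolding lmul_y_eq_binomial_shift x_image_eq[OF \<gamma> c, folded v_def]
    by (rule skew_square_root_inverse_square[OF v(2)])
  show ?thesis
    unfolding y_image_def v_def[symmetric]
  proof (rule the_equality)
    show "mult_C U ev ?S ?S = B_to_C (x_image U ev \<gamma>) \<and> fls_subdegree ?S = 1 \<and> ?S $$ 1 = v"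
      using sq sub S1 by simp
  next
    fix S
    assume S: "mult_C U ev S S = B_to_C (x_image U ev \<gamma>) \<and> fls_subdegree S = 1 \<and> S $$ 1 = v"
    show "S = ?S"
      by (rule skew_square_root_unique[where s = 2 and e = "- 1/2" and p = 1])
         (use S sq sub S1 nz in \<open>simp_all add: lmul_y_eq_binomial_shift\<close>)
  qed
qed

end

theorem theorem2p2p3:
  fixes \<Gamma> :: "(complex^2^2) set"
    and U :: "complex set"
    and ev :: "'r::idom \<Rightarrow> complex \<Rightarrow> complex"
    and \<gamma> :: "complex^2^2"
    and a b c d :: complex
  assumes "homographic_algebra \<Gamma> U ev"
    and "\<gamma> \<in> \<Gamma>"
    and "\<gamma> = vector [vector [a, b], vector [c, d]]"
  shows "act_B U ev \<gamma> fls_X =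
           laurent_sum (\<lambda>n. n + 1)
             (\<lambda>n. scalar U ev (fact (n + 1)) * (elem U ev (\<lambda>z. 1 / (c * z + d)))^2
                   * (elem U ev (\<lambda>z. c / (c * z + d)))^n)
       \<and> act_C U ev \<gamma> fls_X =
           laurent_sum (\<lambda>u. 2 * u + 1)
             (\<lambda>u. scalar U ev (fact (2 * u + 1) * fact (2 * u) / (16^u * (fact u)^3))
                   * elem U ev (\<lambda>z. 1 / (c * z + d))
                   * (elem U ev (\<lambda>z. c / (c * z + d)))^u)"
proof -
  interpret homographic_algebra \<Gamma> U ev by (rule assms(1))
  have c: "\<gamma>$2$1 = c" and denom: "denom \<gamma> = (\<lambda>z. c * z + d)"
    unfolding assms(3) by (simp_all add: denom_def fun_eq_iff vector_2)
  let ?v = "elem U ev (\<lambda>z. 1 / (c * z + d))"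
  have w: "elem U ev (\<lambda>z. c / (c * z + d)) = scalar U ev c * ?v"
    using denom_elem(3)[OF assms(2) c] by (simp add: denom)
  have \<alpha>: "hom_act U ev \<gamma> 0 = 0" "hom_act U ev \<gamma> 1 = 1"
    using hom_act_const[OF assms(2)] ev_zero ev_one by blast+
  have "act_B U ev \<gamma> fls_X = x_image U ev \<gamma>"
    unfolding act_B_def lmul_x_eq_binomial_shift
    by (rule skew_extend_X) (auto simp: \<alpha> x_image_eq[OF assms(2) c] inj_def intro!: laurent_sum_nth(2))
  moreover have "act_C U ev \<gamma> fls_X = y_image U ev \<gamma>"
    unfolding act_C_def lmul_y_eq_binomial_shift
    by (rule skew_extend_X) (auto simp: \<alpha> y_image_eq[OF assms(2) c] inj_def intro!: laurent_sum_nth(2))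
  ultimately show ?thesis
    unfolding x_image_eq[OF assms(2) c] y_image_eq[OF assms(2) c] denom w
    by (simp only: sqrt_coeff_fact scal_mult scal_power power_mult_distrib power_add power_one_right mult_ac)
qed

end
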